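(* (1) Let $\mathcal{E}$ be the set of all fields, up to isomorphism, with only finitely many maximal subrings. Then $|\mathcal{E}|=2^{\aleph_0}$. (2) Let $\mathcal{E}'$ be the set of all fields, up to isomorphism, which have at least one maximal subring but have only finitely many maximal subrings. Then $|\mathcal{E}'|=2^{\aleph_0}$.
   Context: All rings are commutative with $1\neq 0$ and subrings are unital. A proper subring $S$ of a ring $R$ is a maximal subring of $R$ if it is maximal with respect to inclusion among all proper subrings of $R$ (a subring of a field need not be a field). *)

theory Defs
  imports
    "HOL-Algebra.QuotRing"
    "HOL-Algebra.Subrings"
    "HOL-Library.Equipollence"
begin

definition maximal_subring :: "'a set \<Rightarrow> ('a, 'm) ring_scheme \<Rightarrow> bool" where
  "maximal_subring S R \<longleftrightarrow>
     subring S R \<and> S \<noteq> carrier R \<and>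
     (\<forall>T. subring T R \<and> S \<subseteq> T \<and> T \<noteq> carrier R \<longrightarrow> T = S)"

definition maximal_subrings :: "('a, 'm) ring_scheme \<Rightarrow> 'a set set" where
  "maximal_subrings R = {S. maximal_subring S R}"

text \<open>
  The fields of all sizes do not live on a single type, so "all fields" is rendered as
  "all fields whose carrier is a subset of the type \<open>'a\<close>", with \<open>'a\<close> an arbitrary type parameter.
  Any given set of fields can be copied into one sufficiently large type, so a cardinality
  that is the same for every infinite \<open>'a\<close> is the cardinality over all fields.
\<close>

definition finmax_fields :: "'a ring set" where
  "finmax_fields = {K. field K \<and> finite (maximal_subrings K)}"

definition finmax_fields_nonempty :: "'a ring set" where
  "finmax_fields_nonempty =
     {K. field K \<and> maximal_subrings K \<noteq> {} \<and> finite (maximal_subrings K)}"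

text \<open>
  Isomorphism only sees the operations on the carrier, so records that differ merely in the
  values of the operations outside the carrier fall into the same class.
\<close>

definition iso_classes :: "'a ring set \<Rightarrow> 'a ring set set" where
  "iso_classes \<F> = \<F> // {(K, L). K \<in> \<F> \<and> L \<in> \<F> \<and> K \<simeq> L}"

lemma equiv_ring_iso:
  assumes "\<And>K. K \<in> \<F> \<Longrightarrow> ring K"
  shows "equiv \<F> {(K, L). K \<in> \<F> \<and> L \<in> \<F> \<and> K \<simeq> L}"
proof (rule equivI)
  show "{(K, L). K \<in> \<F> \<and> L \<in> \<F> \<and> K \<simeq> L} \<subseteq> \<F> \<times> \<F>"
    by auto
  show "refl_on \<F> {(K, L). K \<in> \<F> \<and> L \<in> \<F> \<and> K \<simeq> L}"
    by (auto simp: refl_on_def ring_iso_refl)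
  show "sym {(K, L). K \<in> \<F> \<and> L \<in> \<F> \<and> K \<simeq> L}"
    using assms by (auto simp: sym_def intro: ring_iso_sym)
  show "trans {(K, L). K \<in> \<F> \<and> L \<in> \<F> \<and> K \<simeq> L}"
    by (auto simp: trans_def intro: ring_iso_trans)
qed

end

theory Submission
  imports Defs "HOL-Algebra.Finite_Extensions" "HOL-Algebra.Weak_Morphisms"
    "HOL-Algebra.Algebraic_Closure_Type"
begin

text \<open>
  Both upper bounds come from the fact that a field with only finitely many maximal subrings is
  countable. Up to isomorphism a countable field is determined by the graph of its two operations,
  copied to the natural numbers, and this graph is a single subset of a countable set. For both
  lower bounds it is enough to have continuum many pairwise non-isomorphic countable fields with
  exactly one maximal subring each.

  Let \<open>K\<close> be an uncountable field. Only countably many elements are algebraic over a given countable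
  infinite subring, so some \<open>t\<close> is transcendental over it. By Zorn's lemma this subring lies in a
  subring \<open>A\<close> that is maximal among those over which \<open>t\<close> is transcendental. This \<open>A\<close> is a field, and
  \<open>K\<close> is algebraic over \<open>A(t)\<close>. For \<open>a \<in> A\<close> put \<open>s = t + a\<close> and let \<open>M\<close> be maximal among the subrings
  that contain \<open>A[s]\<close> but not \<open>1/s\<close>. By Chevalley's argument \<open>M\<close> is a valuation ring
  (\<open>valuation_property\<close>). If \<open>x \<notin> M\<close>, then \<open>y = 1/x\<close> lies in \<open>M\<close> but not in \<open>A\<close>, so \<open>y\<close> is algebraic
  over \<open>A[s]\<close>, and the lowest terms of an algebraic relation give \<open>s^l \<in> y M\<close>, that is
  \<open>x \<in> s^(-l) M\<close>. Every subring that properly contains \<open>M\<close> contains \<open>1/s\<close>, hence it is all of \<open>K\<close>,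
  and \<open>M\<close> is a maximal subring (\<open>maximal_avoiding_is_maximal_subring\<close>). For another element \<open>b\<close> of
  \<open>A\<close> the inverse of \<open>t + b\<close> does lie in \<open>M\<close>, so the infinitely many choices of \<open>a\<close> yield infinitely
  many maximal subrings.

  The fields for the lower bound lie in an algebraic closure of the field with two elements.
  There the subrings correspond to Steinitz numbers, here rendered as ideals of the set of positive
  integers ordered by divisibility: an ideal \<open>N\<close> corresponds to the union of the fields with \<open>2^n\<close>
  elements for \<open>n \<in> N\<close> (\<open>subring_is_frob_union\<close>, \<open>frob_union_mono_iff\<close>). Maximal subrings then
  correspond to lowering one finite nonzero exponent of the Steinitz number by one. For a set \<open>S\<close> of
  odd primes the Steinitz number \<open>2\<close> times the product of all \<open>q^\<infinity>\<close> with \<open>q \<in> S\<close> has just one such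
  exponent (\<open>maximal_subrings_steinitz_field\<close>), and \<open>S\<close> can be read off the field because \<open>q \<in> S\<close> holds
  exactly if \<open>X^(2^q) - X\<close> has a root besides \<open>0\<close> and \<open>1\<close> (\<open>mem_iff_steinitz_field\<close>).
\<close>

section \<open>Polynomial expressions and transcendental elements\<close>

context field
begin

text \<open>
  Polynomials are given by a length and a total family of coefficients, without a condition on the
  leading one. In this form a polynomial in two variables is a family of families, and the variables
  can be interchanged (\<open>horner_swap\<close>).
\<close>

primrec horner :: "nat \<Rightarrow> (nat \<Rightarrow> 'a) \<Rightarrow> 'a \<Rightarrow> 'a" where
  "horner 0 c x = \<zero>"
| "horner (Suc n) c x = c 0 \<oplus> x \<otimes> horner n (\<lambda>i. c (Suc i)) x"

lemma horner_in_subring: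
  assumes "subring A R" "\<And>i. c i \<in> A" "x \<in> A"
  shows "horner n c x \<in> A"
  using assms(2)
proof (induction n arbitrary: c)
  case 0 then show ?case using subringE(2)[OF assms(1)] by simp
next
  case (Suc n) then show ?case
    using subringE(6,7)[OF assms(1)] assms(3) by simp
qed

lemma horner_closed [simp]:
  assumes "\<And>i. c i \<in> carrier R" "x \<in> carrier R"
  shows "horner n c x \<in> carrier R"
  by (rule horner_in_subring[OF carrier_is_subring assms])

lemma horner_zero [simp]: "x \<in> carrier R \<Longrightarrow> horner n (\<lambda>i. \<zero>) x = \<zero>"
  by (induction n) auto

lemma horner_add:
  assumes "\<And>i. c i \<in> carrier R" "\<And>i. d i \<in> carrier R" "x \<in> carrier R"
  shows "horner n (\<lambda>i. c i \<oplus> d i) x = horner n c x \<oplus> horner n d x"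
  using assms(1,2)
proof (induction n arbitrary: c d)
  case (Suc n)
  note [simp] = Suc.prems assms(3)
  have "horner (Suc n) (\<lambda>i. c i \<oplus> d i) x =
     (c 0 \<oplus> d 0) \<oplus> x \<otimes> (horner n (\<lambda>i. c (Suc i)) x \<oplus> horner n (\<lambda>i. d (Suc i)) x)"
    using Suc.IH[of "\<lambda>i. c (Suc i)" "\<lambda>i. d (Suc i)"] by simp
  then show ?case by (simp add: r_distr a_ac)
qed simp

lemma horner_scale:
  assumes "\<And>i. c i \<in> carrier R" "a \<in> carrier R" "x \<in> carrier R"
  shows "horner n (\<lambda>i. a \<otimes> c i) x = a \<otimes> horner n c x"
  using assms(1)
proof (induction n arbitrary: c)
  case (Suc n)
  note [simp] = Suc.prems assms(2,3)
  have "horner (Suc n) (\<lambda>i. a \<otimes> c i) x = a \<otimes> c 0 \<oplus> x \<otimes> (a \<otimes> horner n (\<lambda>i. c (Suc i)) x)"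
    using Suc.IH[of "\<lambda>i. c (Suc i)"] by simp
  then show ?case by (simp add: r_distr m_ac)
qed (use assms in simp)

lemma horner_snoc:
  assumes "\<And>i. c i \<in> carrier R" "x \<in> carrier R"
  shows "horner (Suc n) c x = horner n c x \<oplus> c n \<otimes> x [^] n"
  using assms(1)
proof (induction n arbitrary: c)
  case (Suc n)
  note [simp] = Suc.prems assms(2)
  have "horner (Suc (Suc n)) c x = c 0 \<oplus> x \<otimes> (horner n (\<lambda>i. c (Suc i)) x \<oplus> c (Suc n) \<otimes> x [^] n)"
    using Suc.IH[of "\<lambda>i. c (Suc i)"] by simp
  then show ?case by (simp add: r_distr a_ac m_ac)
qed (use assms in simp)

lemma horner_cong:
  assumes "\<And>i. i < n \<Longrightarrow> c i = d i"
  shows "horner n c x = horner n d x"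
  using assms
proof (induction n arbitrary: c d)
  case (Suc n)
  have "horner n (\<lambda>i. c (Suc i)) x = horner n (\<lambda>i. d (Suc i)) x"
    by (rule Suc.IH) (simp add: Suc.prems)
  then show ?case using Suc.prems[of 0] by simp
qed simp

lemma horner_swap:
  assumes "\<And>i j. d j i \<in> carrier R" "w \<in> carrier R" "t \<in> carrier R"
  shows "horner m (\<lambda>j. horner n (d j) w) t = horner n (\<lambda>i. horner m (\<lambda>j. d j i) t) w"
  using assms(1)
proof (induction m arbitrary: d)
  case (Suc m)
  note [simp] = Suc.prems assms(2,3)
  have "horner (Suc m) (\<lambda>j. horner n (d j) w) t =
        horner n (d 0) w \<oplus> t \<otimes> horner n (\<lambda>i. horner m (\<lambda>j. d (Suc j) i) t) w"
    using Suc.IH[of "\<lambda>j. d (Suc j)"] by simp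
  also have "\<dots> = horner n (\<lambda>i. d 0 i \<oplus> t \<otimes> horner m (\<lambda>j. d (Suc j) i) t) w"
    by (simp add: horner_add horner_scale)
  finally show ?case by simp
qed (use assms in simp)

lemma horner_pad:
  assumes "\<And>i. c i \<in> carrier R" "x \<in> carrier R" "n \<le> m"
  shows "horner m (\<lambda>i. if i < n then c i else \<zero>) x = horner n c x"
  using \<open>n \<le> m\<close>
proof (induction m rule: dec_induct)
  case base then show ?case by (rule horner_cong) simp
next
  case (step m)
  then show ?case using assms by (simp add: horner_snoc del: horner.simps)
qed

text \<open>
  Splitting off the largest power of \<open>x\<close> that divides the polynomial. This is what makes the term of
  lowest degree of an algebraic relation available.
\<close>

lemma horner_leading:
  assumes "subring B R" "\<And>i. c i \<in> B" "x \<in> B" "j < n" "c j \<noteq> \<zero>"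
  shows "\<exists>k<n. c k \<noteq> \<zero> \<and> (\<exists>m\<in>B. horner n c x = x [^] k \<otimes> (c k \<oplus> x \<otimes> m))"
  using assms(2,4,5)
proof (induction n arbitrary: c j)
  case (Suc n)
  have BC: "B \<subseteq> carrier R" using subringE(1)[OF assms(1)] .
  have m: "horner n (\<lambda>i. c (Suc i)) x \<in> B"
    by (rule horner_in_subring[OF assms(1)]) (use Suc.prems assms in auto)
  have [simp]: "c i \<in> carrier R" "x \<in> carrier R" for i using Suc.prems(1) assms(3) BC by auto
  show ?case
  proof (cases "c 0 = \<zero>")
    case False
    show ?thesis
      by (rule exI[of _ 0]) (use False m BC in \<open>auto intro!: bexI[of _ "horner n (\<lambda>i. c (Suc i)) x"]\<close>)
  next
    case True
    then obtain i where i: "j = Suc i" using Suc.prems by (cases j) auto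
    then obtain k l where k: "k < n" "c (Suc k) \<noteq> \<zero>" "l \<in> B"
      "horner n (\<lambda>i. c (Suc i)) x = x [^] k \<otimes> (c (Suc k) \<oplus> x \<otimes> l)"
      using Suc.IH[of "\<lambda>i. c (Suc i)" i] Suc.prems by auto
    have [simp]: "l \<in> carrier R" using k(3) BC by auto
    have "horner (Suc n) c x = x [^] Suc k \<otimes> (c (Suc k) \<oplus> x \<otimes> l)"
      using True by (simp add: k(4) m_ac)
    then show ?thesis using k by (intro exI[of _ "Suc k"]) auto
  qed
qed simp

lemma simple_extension_horner:
  assumes "subring A R" "x \<in> carrier R"
  shows "simple_extension A x = {horner n c x | n c. \<forall>i. c i \<in> A}"
proof
  note A = subringE[OF assms(1)]
  show "simple_extension A x \<subseteq> {horner n c x | n c. \<forall>i. c i \<in> A}"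
  proof
    fix y assume "y \<in> simple_extension A x"
    then show "y \<in> {horner n c x | n c. \<forall>i. c i \<in> A}"
    proof induction
      case zero
      show ?case using A(2) by (auto intro!: exI[of _ 0] exI[of _ "\<lambda>_. \<zero>"])
    next
      case (lin k1 k2)
      then obtain n c where c: "k1 = horner n c x" "\<forall>i. c i \<in> A" by auto
      have "k1 \<in> carrier R" "k2 \<in> carrier R"
        using lin simple_extension_in_carrier[OF A(1) assms(2)] A(1) by auto
      then have "k1 \<otimes> x \<oplus> k2 = horner (Suc n) (case_nat k2 c) x"
        using assms(2) c by (simp add: a_ac m_ac)
      moreover have "\<forall>i. case_nat k2 c i \<in> A" using c(2) lin(2) by (auto split: nat.splits)
      ultimately show ?case by blast
    qed
  qed
  show "{horner n c x | n c. \<forall>i. c i \<in> A} \<subseteq> simple_extension A x"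
    using horner_in_subring[OF simple_extension_is_subring[OF assms] _ simple_extension_mem[OF assms]]
      simple_extension_incl[OF A(1) assms(2)] by blast
qed

text \<open>
  Transcendence is used for subrings that are not known to be fields, and with coefficient families
  that may end in zeros.
\<close>

definition transc :: "'a set \<Rightarrow> 'a \<Rightarrow> bool" where
  "transc A t \<longleftrightarrow> (\<forall>n c. (\<forall>i. c i \<in> A) \<longrightarrow> horner n c t = \<zero> \<longrightarrow> (\<forall>i<n. c i = \<zero>))"

text \<open>
  Taylor expansion; that the top coefficient is unchanged shows that the shifted polynomial is again
  nonzero.
\<close>

lemma horner_shift:
  assumes "subring A R" "a \<in> A" "\<And>i. c i \<in> A"
  shows "\<exists>d. (\<forall>i. d i \<in> A) \<and> d n = c n \<and>
    (\<forall>x\<in>carrier R. horner (Suc n) c (x \<oplus> a) = horner (Suc n) d x)"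
proof -
  note A = subringE[OF assms(1)]
  have [simp]: "a \<in> carrier R" using A(1) assms(2) by auto
  show ?thesis
    using assms(3)
  proof (induction n arbitrary: c)
    case 0
    then show ?case using A(1) by (intro exI[of _ c]) auto
  next
    case (Suc n)
    then obtain d where d: "\<And>i. d i \<in> A" "d n = c (Suc n)"
      "\<And>x. x \<in> carrier R \<Longrightarrow> horner (Suc n) (\<lambda>i. c (Suc i)) (x \<oplus> a) = horner (Suc n) d x"
      by metis
    have [simp]: "d i \<in> carrier R" "c i \<in> carrier R" for i using d(1) Suc.prems A(1) by auto
    define z where "z i = (if i < Suc n then d i else \<zero>)" for i
    have z: "z i \<in> A" "z i \<in> carrier R" for i using d(1) A(2) by (auto simp: z_def)
    define e where "e i = a \<otimes> z i \<oplus> case_nat (c 0) d i" for i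
    have "horner (Suc (Suc n)) c (x \<oplus> a) = horner (Suc (Suc n)) e x" if [simp]: "x \<in> carrier R" for x
    proof -
      have "horner (Suc (Suc n)) c (x \<oplus> a) = c 0 \<oplus> (x \<oplus> a) \<otimes> horner (Suc n) d x"
        using d(3) by simp
      also have "\<dots> = a \<otimes> horner (Suc n) d x \<oplus> (c 0 \<oplus> x \<otimes> horner (Suc n) d x)"
        by (simp add: l_distr a_ac del: horner.simps)
      also have "a \<otimes> horner (Suc n) d x = horner (Suc (Suc n)) (\<lambda>i. a \<otimes> z i) x"
        using horner_pad[of d x "Suc n" "Suc (Suc n)"] z
        by (simp add: horner_scale z_def[abs_def] del: horner.simps)
      also have "c 0 \<oplus> x \<otimes> horner (Suc n) d x = horner (Suc (Suc n)) (case_nat (c 0) d) x"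
        by simp
      also have "horner (Suc (Suc n)) (\<lambda>i. a \<otimes> z i) x \<oplus> \<dots> = horner (Suc (Suc n)) e x"
        unfolding e_def[abs_def]
        by (rule horner_add[symmetric]) (auto simp: z split: nat.splits)
      finally show ?thesis .
    qed
    moreover have "e i \<in> A" for i
      using z d Suc.prems assms(2) A(6,7) by (auto simp: e_def split: nat.splits)
    moreover have "e (Suc n) = c (Suc n)"
      using d(2) by (simp add: e_def z_def)
    ultimately show ?case by blast
  qed
qed

lemma transc_shift:
  assumes "subring A R" "a \<in> A" "t \<in> carrier R" "transc A t"
  shows "transc A (t \<oplus> a)"
  unfolding transc_def
proof (intro allI impI)
  note A = subringE[OF assms(1)]
  fix n c i
  assume c: "\<forall>i. c i \<in> A" and "horner n c (t \<oplus> a) = \<zero>" "i < n"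
  have [simp]: "a \<in> carrier R" "c i \<in> carrier R" for i using A(1) assms(2) c by auto
  have "horner n c (t \<oplus> a) = \<zero> \<Longrightarrow> \<forall>i<n. c i = \<zero>"
  proof (induction n)
    case (Suc n)
    obtain d where d: "\<And>i. d i \<in> A" "d n = c n" "horner (Suc n) d t = \<zero>"
      using horner_shift[OF assms(1,2), of c n] c assms(3) Suc.prems by metis
    then have "c n = \<zero>" using assms(4) unfolding transc_def by (metis lessI)
    then have "horner n c (t \<oplus> a) = \<zero>"
      using Suc.prems assms(3) by (simp add: horner_snoc del: horner.simps)
    then show ?case using Suc.IH \<open>c n = \<zero>\<close> less_Suc_eq by auto
  qed simp
  then show "c i = \<zero>" using \<open>horner n c (t \<oplus> a) = \<zero>\<close> \<open>i < n\<close> by blast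
qed

section \<open>Localizations and applications of Zorn's lemma\<close>

text \<open>
  The subring \<open>A[1/v]\<close> of the field, for nonzero \<open>v\<close>. It serves twice to show that a subring with a maximality property
  contains the inverse of one of its elements.
\<close>

definition localization :: "'a set \<Rightarrow> 'a \<Rightarrow> 'a set" where
  "localization A v = {x \<in> carrier R. \<exists>N::nat. v [^] N \<otimes> x \<in> A}"

lemma localizationI: "x \<in> carrier R \<Longrightarrow> v [^] (N::nat) \<otimes> x \<in> A \<Longrightarrow> x \<in> localization A v"
  by (auto simp: localization_def)

lemma localization_incl:
  assumes "subring A R" shows "A \<subseteq> localization A v"
  using subringE(1)[OF assms] by (auto simp: localization_def intro!: exI[of _ 0])

lemma pow_in_subring:
  assumes "subring A R" "v \<in> A" shows "v [^] (N::nat) \<in> A"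
  using subringE(3,6)[OF assms(1)] assms(2) by (induction N) auto

lemma pow_nonzero:
  assumes "v \<noteq> \<zero>" "v \<in> carrier R" shows "v [^] (N::nat) \<noteq> \<zero>"
  using assms integral by (induction N) auto

lemma localization_subring:
  assumes "subring A R" "v \<in> A"
  shows "subring (localization A v) R"
proof (rule subringI)
  note A = subringE[OF assms(1)]
  have v [simp]: "v \<in> carrier R" using A(1) assms(2) by auto
  show "localization A v \<subseteq> carrier R" by (auto simp: localization_def)
  show "\<one> \<in> localization A v" using A(3) localization_incl[OF assms(1)] by blast
  fix x assume "x \<in> localization A v"
  then obtain N where x [simp]: "x \<in> carrier R" and N: "v [^] (N::nat) \<otimes> x \<in> A" by (auto simp: localization_def)
  have "v [^] N \<otimes> (\<ominus> x) \<in> A" using A(5)[OF N] by (simp add: r_minus)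
  then show "\<ominus> x \<in> localization A v" by (intro localizationI) simp_all
  fix y assume "y \<in> localization A v"
  then obtain K where y [simp]: "y \<in> carrier R" and K: "v [^] (K::nat) \<otimes> y \<in> A" by (auto simp: localization_def)
  have comm: "(p \<otimes> q) \<otimes> (x \<oplus> y) = q \<otimes> (p \<otimes> x) \<oplus> p \<otimes> (q \<otimes> y)"
    if "p \<in> carrier R" "q \<in> carrier R" for p q
    using that by (simp add: r_distr) (simp add: m_ac)
  have "v [^] (N + K) \<otimes> (x \<otimes> y) = (v [^] N \<otimes> x) \<otimes> (v [^] K \<otimes> y)"
    by (simp add: nat_pow_mult[symmetric] m_ac)
  also have "\<dots> \<in> A" using A(6) N K by blast
  finally show "x \<otimes> y \<in> localization A v" by (intro localizationI) simp_all
  have "v [^] (N + K) \<otimes> (x \<oplus> y) = v [^] K \<otimes> (v [^] N \<otimes> x) \<oplus> v [^] N \<otimes> (v [^] K \<otimes> y)"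
    unfolding nat_pow_mult[OF v, symmetric] using comm by simp
  also have "\<dots> \<in> A" using A(6,7) N K pow_in_subring[OF assms] by blast
  finally show "x \<oplus> y \<in> localization A v" by (intro localizationI) simp_all
qed

lemma inv_in_localization:
  assumes "subring A R" "v \<in> A" "v \<noteq> \<zero>"
  shows "inv v \<in> localization A v"
proof -
  have "v \<in> Units R" using subringE(1)[OF assms(1)] assms(2,3) field_Units by auto
  then have "v [^] (1::nat) \<otimes> inv v = \<one>" "inv v \<in> carrier R" by (simp_all add: Units_closed)
  then show ?thesis using subringE(3)[OF assms(1)] by (intro localizationI[of _ v 1]) simp_all
qed

lemma Union_chain_subring:
  assumes "\<C> \<noteq> {}" "subset.chain \<A> \<C>" "\<And>A. A \<in> \<A> \<Longrightarrow> subring A R"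
  shows "subring (\<Union>\<C>) R"
proof (rule subringI)
  have sub: "subring A R" if "A \<in> \<C>" for A
    using assms(2,3) that unfolding subset_chain_def by auto
  note S = subringE[OF sub]
  show "\<Union>\<C> \<subseteq> carrier R" using S(1) by blast
  show "\<one> \<in> \<Union>\<C>" using S(3) assms(1) by blast
  show "\<ominus> h \<in> \<Union>\<C>" if "h \<in> \<Union>\<C>" for h using S(5) that by blast
  have both: "\<exists>C\<in>\<C>. h \<in> C \<and> k \<in> C" if "h \<in> \<Union>\<C>" "k \<in> \<Union>\<C>" for h k
    using that assms(2) unfolding subset_chain_def by blast
  fix h k assume "h \<in> \<Union>\<C>" "k \<in> \<Union>\<C>"
  then obtain C where "C \<in> \<C>" "h \<in> C" "k \<in> C" using both by blast
  then show "h \<otimes> k \<in> \<Union>\<C>" "h \<oplus> k \<in> \<Union>\<C>" using S(6,7) by blast+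
qed

lemma ex_maximal_avoiding:
  assumes "subring A R" "u \<notin> A"
  obtains M where "subring M R" "A \<subseteq> M" "u \<notin> M"
    "\<And>T. subring T R \<Longrightarrow> M \<subset> T \<Longrightarrow> u \<in> T"
proof -
  \<comment> \<open>Zorn's lemma applies because a union of a chain of such subrings avoids the element, too.\<close>
  define \<A> where "\<A> = {M. subring M R \<and> A \<subseteq> M \<and> u \<notin> M}"
  have "\<exists>M\<in>\<A>. \<forall>T\<in>\<A>. M \<subseteq> T \<longrightarrow> T = M"
  proof (rule subset_Zorn_nonempty)
    show "\<A> \<noteq> {}" using assms by (auto simp: \<A>_def)
    fix \<C> assume C: "\<C> \<noteq> {}" "subset.chain \<A> \<C>"
    then show "\<Union>\<C> \<in> \<A>"
      using Union_chain_subring[OF C] by (auto simp: \<A>_def subset_chain_def)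
  qed
  then obtain M where M: "subring M R" "A \<subseteq> M" "u \<notin> M"
    and max: "\<And>T. T \<in> \<A> \<Longrightarrow> M \<subseteq> T \<Longrightarrow> T = M" by (auto simp: \<A>_def)
  have "u \<in> T" if "subring T R" "M \<subset> T" for T
    using max[of T] M(2) that unfolding \<A>_def by blast
  then show thesis using that M by blast
qed

lemma ex_maximal_transc:
  assumes "subring A\<^sub>0 R" "transc A\<^sub>0 t"
  obtains A where "subring A R" "A\<^sub>0 \<subseteq> A" "transc A t"
    "\<And>T. subring T R \<Longrightarrow> A \<subset> T \<Longrightarrow> \<not> transc T t"
proof -
  define \<A> where "\<A> = {A. subring A R \<and> A\<^sub>0 \<subseteq> A \<and> transc A t}"
  have "\<exists>M\<in>\<A>. \<forall>T\<in>\<A>. M \<subseteq> T \<longrightarrow> T = M"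
  proof (rule subset_Zorn_nonempty)
    show "\<A> \<noteq> {}" using assms by (auto simp: \<A>_def)
    fix \<C> assume C: "\<C> \<noteq> {}" "subset.chain \<A> \<C>"
    have "transc (\<Union>\<C>) t"
      unfolding transc_def
    proof (intro allI impI)
      fix n c i assume c: "\<forall>i. c i \<in> \<Union>\<C>" "horner n c t = \<zero>" "i < n"
      have "finite (c ` {..<n})" "c ` {..<n} \<subseteq> \<Union>\<C>" using c by auto
      then obtain B where B: "B \<in> \<C>" "c ` {..<n} \<subseteq> B"
        using finite_subset_Union_chain[OF _ _ C] by metis
      then have B': "subring B R" "transc B t" using C unfolding \<A>_def subset_chain_def by auto
      define d where "d i = (if i < n then c i else \<zero>)" for i
      have "\<forall>i. d i \<in> B" using B(2) subringE(2)[OF B'(1)] by (auto simp: d_def)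
      moreover have "horner n d t = \<zero>" using horner_cong[of n d c t] c(2) by (simp add: d_def)
      ultimately have "d i = \<zero>" using B'(2) c(3) unfolding transc_def by blast
      then show "c i = \<zero>" using c(3) by (simp add: d_def)
    qed
    then show "\<Union>\<C> \<in> \<A>"
      using Union_chain_subring[OF C] C by (fastforce simp: \<A>_def subset_chain_def)
  qed
  then obtain M where M: "subring M R" "A\<^sub>0 \<subseteq> M" "transc M t"
    and max: "\<And>T. T \<in> \<A> \<Longrightarrow> M \<subseteq> T \<Longrightarrow> T = M" by (auto simp: \<A>_def)
  have "\<not> transc T t" if "subring T R" "M \<subset> T" for T
    using max[of T] M(2) that unfolding \<A>_def by blast
  then show thesis using that M by blast
qed

text \<open>
  The element \<open>t\<close> is still transcendental over the localization at \<open>a\<close>, since the denominators of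
  finitely many coefficients can be cleared by one power of \<open>a\<close>. By maximality the localization is not
  larger than \<open>A\<close>.
\<close>

lemma maximal_transc_inv:
  assumes A: "subring A R" "transc A t" "t \<in> carrier R"
    and max: "\<And>T. subring T R \<Longrightarrow> A \<subset> T \<Longrightarrow> \<not> transc T t"
    and a: "a \<in> A" "a \<noteq> \<zero>"
  shows "inv a \<in> A"
proof -
  have [simp]: "a \<in> carrier R" using a subringE(1)[OF A(1)] by auto
  have "transc (localization A a) t"
    unfolding transc_def
  proof (intro allI impI)
    fix n c i assume c: "\<forall>i. c i \<in> localization A a" "horner n c t = \<zero>" "i < n"
    have cc [simp]: "c i \<in> carrier R" for i using c(1) by (auto simp: localization_def)
    have "\<exists>N::nat. \<forall>i<n. a [^] N \<otimes> c i \<in> A" for n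
    proof (induction n)
      case (Suc n)
      then obtain N K :: nat where N: "\<forall>i<n. a [^] N \<otimes> c i \<in> A" and K: "a [^] K \<otimes> c n \<in> A"
        using c(1) unfolding localization_def by blast
      have "a [^] (N + K) \<otimes> c i \<in> A" if "i < Suc n" for i
      proof (cases "i = n")
        case True
        have "a [^] (N + K) \<otimes> c i = a [^] N \<otimes> (a [^] K \<otimes> c n)"
          by (simp add: True nat_pow_mult[symmetric] m_ac)
        then show ?thesis using K pow_in_subring[OF A(1) a(1)] subringE(6)[OF A(1)] by simp
      next
        case False
        have "a [^] (N + K) \<otimes> c i = a [^] K \<otimes> (a [^] N \<otimes> c i)"
          by (simp add: nat_pow_mult[symmetric] m_ac)
        then show ?thesis using N False that pow_in_subring[OF A(1) a(1)] subringE(6)[OF A(1)] by simp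
      qed
      then show ?case by blast
    qed simp
    then obtain N :: nat where N: "\<And>i. i < n \<Longrightarrow> a [^] N \<otimes> c i \<in> A" by metis
    define d where "d i = (if i < n then a [^] N \<otimes> c i else \<zero>)" for i
    have "\<forall>i. d i \<in> A" using N subringE(2)[OF A(1)] by (auto simp: d_def)
    moreover have "horner n d t = a [^] N \<otimes> horner n c t"
      using horner_cong[of n d "\<lambda>i. a [^] N \<otimes> c i" t] A(3) by (simp add: d_def horner_scale)
    ultimately have "d i = \<zero>" using A(2) c(2,3) unfolding transc_def by simp
    moreover have "a [^] N \<noteq> \<zero>" using a(2) by (rule pow_nonzero) simp
    ultimately show "c i = \<zero>" using c(3) integral_iff[of "a [^] N" "c i"] by (simp add: d_def)
  qed
  then have "localization A a = A"
    using max[OF localization_subring[OF A(1) a(1)]] localization_incl[OF A(1), of a] by blast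
  then show ?thesis using inv_in_localization[OF A(1) a] by simp
qed

lemma inv_props:
  assumes "x \<in> carrier R" "x \<noteq> \<zero>"
  shows "inv x \<in> carrier R" "x \<otimes> inv x = \<one>" "inv x \<otimes> x = \<one>"
  using assms field_Units Units_closed by (auto intro: Units_inv_closed Units_r_inv Units_l_inv)

section \<open>Subrings maximal with respect to avoiding an element\<close>

text \<open>
  Reversing the coefficients turns a polynomial in \<open>1/x\<close> into a polynomial in \<open>x\<close>.
\<close>

lemma horner_rev:
  assumes "subring M R" "x \<in> carrier R" "y \<in> carrier R" "x \<otimes> y = \<one>" "\<And>i. b i \<in> M"
  shows "\<exists>e. (\<forall>i. e i \<in> M) \<and> x [^] k \<otimes> (y \<otimes> horner k b y) = horner k e x"
  using assms(5)
proof (induction k arbitrary: b)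
  case 0
  then show ?case using assms(2,3) by (intro exI[of _ b]) auto
next
  case (Suc k)
  have MC: "M \<subseteq> carrier R" using subringE(1)[OF assms(1)] .
  from Suc.IH[of "\<lambda>i. b (Suc i)"] Suc.prems obtain e where
    e: "\<And>i. e i \<in> M" "x [^] k \<otimes> (y \<otimes> horner k (\<lambda>i. b (Suc i)) y) = horner k e x" by blast
  define e' where "e' i = (if i < k then e i else b 0)" for i
  define h where "h = horner k (\<lambda>i. b (Suc i)) y"
  have [simp]: "b i \<in> carrier R" "e i \<in> carrier R" for i using Suc.prems e(1) MC by auto
  have h [simp]: "h \<in> carrier R" unfolding h_def using assms(3) by simp
  note [simp] = assms(2,3)
  have e'M: "\<forall>i. e' i \<in> M" using e(1) Suc.prems by (auto simp: e'_def)
  then have [simp]: "e' i \<in> carrier R" for i using MC by auto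
  have "x [^] Suc k \<otimes> (y \<otimes> horner (Suc k) b y) = x [^] k \<otimes> ((x \<otimes> y) \<otimes> (b 0 \<oplus> y \<otimes> h))"
    by (simp add: h_def m_assoc)
  also have "\<dots> = x [^] k \<otimes> (y \<otimes> h) \<oplus> b 0 \<otimes> x [^] k"
    by (simp add: assms(4) r_distr) (simp add: a_ac m_ac)
  also have "x [^] k \<otimes> (y \<otimes> h) = horner k e' x"
    using e(2) horner_cong[of k e e' x] by (simp add: h_def e'_def)
  also have "horner k e' x \<oplus> b 0 \<otimes> x [^] k = horner (Suc k) e' x"
    by (subst horner_snoc) (simp_all add: e'_def)
  finally show ?case using e'M by blast
qed

lemma horner_times_power:
  assumes "subring M R" "x \<in> carrier R" "\<And>i. c i \<in> M"
  shows "\<exists>d. (\<forall>i. d i \<in> M) \<and> x [^] (k::nat) \<otimes> horner n c x = horner (k + n) d x"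
proof (induction k)
  case 0
  have "c i \<in> carrier R" for i using assms(3) subringE(1)[OF assms(1)] by auto
  then show ?case using assms by (intro exI[of _ c]) auto
next
  case (Suc k)
  then obtain d where d: "\<And>i. d i \<in> M" "x [^] k \<otimes> horner n c x = horner (k + n) d x" by blast
  have [simp]: "c i \<in> carrier R" "d i \<in> carrier R" "x \<in> carrier R" for i
    using d assms subringE(1)[OF assms(1)] by auto
  have "x [^] Suc k \<otimes> horner n c x = x \<otimes> (x [^] k \<otimes> horner n c x)" by (simp add: m_ac)
  also have "\<dots> = horner (Suc k + n) (case_nat \<zero> d) x" by (simp add: d(2))
  finally have eq: "x [^] Suc k \<otimes> horner n c x = horner (Suc k + n) (case_nat \<zero> d) x" .
  show ?case
    by (rule exI[of _ "case_nat \<zero> d"])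
      (use eq d(1) subringE(2)[OF assms(1)] in \<open>auto split: nat.splits\<close>)
qed

text \<open>
  The next lemmas are Chevalley's argument for the existence of valuation rings, for a subring that
  is maximal with respect to not containing the inverse \<open>u\<close> of \<open>s\<close>.
\<close>

context
  fixes M s u
  assumes M: "subring M R" and s: "s \<in> M" and u: "u \<in> carrier R" "s \<otimes> u = \<one>" "u \<notin> M"
    and max: "\<And>T. subring T R \<Longrightarrow> M \<subset> T \<Longrightarrow> u \<in> T"
begin

lemma M_carrier [simp]: "m \<in> M \<Longrightarrow> m \<in> carrier R"
  using subringE(1)[OF M] by blast

text \<open>
  Every power of \<open>1 + s m\<close> is again of the form \<open>1 + s m'\<close>, and \<open>u (1 + s m') = u + m'\<close>. Hence \<open>u\<close> does
  not enter the localization at \<open>1 + s m\<close>, which by maximality is therefore \<open>M\<close> itself.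
\<close>

lemma one_plus_unit:
  assumes m: "m \<in> M"
  shows "\<one> \<oplus> s \<otimes> m \<noteq> \<zero>" "inv (\<one> \<oplus> s \<otimes> m) \<in> M"
proof -
  note ME = subringE[OF M]
  note [simp] = s m u(1)
  define v where "v = \<one> \<oplus> s \<otimes> m"
  have vM: "v \<in> M" using ME s m by (simp add: v_def)
  have pow: "\<exists>m'\<in>M. v [^] N = \<one> \<oplus> s \<otimes> m'" for N :: nat
  proof (induction N)
    case 0
    then show ?case using ME(2) by (intro bexI[of _ \<zero>]) auto
  next
    case (Suc N)
    then obtain m' where m': "m' \<in> M" "v [^] N = \<one> \<oplus> s \<otimes> m'" by blast
    have "v [^] Suc N = \<one> \<oplus> s \<otimes> (m \<oplus> (m' \<oplus> s \<otimes> m' \<otimes> m))"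
      using m'(1) by (simp add: m'(2) v_def[symmetric]) (simp add: v_def l_distr r_distr a_ac m_ac)
    moreover have "m \<oplus> (m' \<oplus> s \<otimes> m' \<otimes> m) \<in> M" using ME(6,7) m'(1) s m by simp
    ultimately show ?case by blast
  qed
  have key: "u \<in> M" if "v [^] (N::nat) \<otimes> u \<in> M" for N
  proof -
    obtain m' where m': "m' \<in> M" "v [^] N = \<one> \<oplus> s \<otimes> m'" using pow by blast
    have "v [^] N \<otimes> u = u \<oplus> (s \<otimes> u) \<otimes> m'" using m' by (simp add: l_distr) (simp add: m_ac)
    then have "v [^] N \<otimes> u = u \<oplus> m'" using m' u(2) by simp
    then have "u = v [^] N \<otimes> u \<oplus> \<ominus> m'" using m' by (simp add: a_assoc r_neg)
    then show ?thesis using that ME(5,7) m'(1) by metis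
  qed
  have v0: "v \<noteq> \<zero>"
  proof
    assume "v = \<zero>"
    then show False using key[of 1] u ME(2) by simp
  qed
  then show "\<one> \<oplus> s \<otimes> m \<noteq> \<zero>" by (simp add: v_def)
  have "localization M v = M"
  proof (rule ccontr)
    assume "localization M v \<noteq> M"
    then have "u \<in> localization M v" using max[OF localization_subring[OF M vM]] localization_incl[OF M] by blast
    then show False using key u(3) unfolding localization_def by blast
  qed
  then show "inv (\<one> \<oplus> s \<otimes> m) \<in> M" using inv_in_localization[OF M vM v0] by (simp add: v_def)
qed

text \<open>
  In the relation in \<open>y\<close> the constant term can be moved to the left, where it gives a unit
  \<open>1 - s b\<^sub>0\<close> of \<open>M\<close>. After division by this unit and multiplication by a power of \<open>x\<close>, the relation
  expresses a power of \<open>x\<close> by lower ones, and this eliminates the leading term of the relation in \<open>x\<close>.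
\<close>

lemma degree_reduction:
  assumes xy: "x \<in> carrier R" "y \<in> carrier R" "x \<otimes> y = \<one>"
    and a: "\<And>i. a i \<in> M" "\<one> = s \<otimes> horner n a x"
    and b: "\<And>i. b i \<in> M" "\<one> = s \<otimes> horner m b y"
    and "m \<le> n"
  shows "\<exists>n'<n. \<exists>c. (\<forall>i. c i \<in> M) \<and> \<one> = s \<otimes> horner n' c x"
proof -
  note ME = subringE[OF M]
  note [simp] = s xy(1,2) a(1) b(1)
  obtain k where k: "m = Suc k" using b(2) by (cases m) auto
  then obtain l where l: "n = Suc l" "k \<le> l" using \<open>m \<le> n\<close> by (cases n) auto
  define r where "r = horner k (\<lambda>i. b (Suc i)) y"
  have [simp]: "r \<in> carrier R" by (simp add: r_def)
  define v where "v = \<one> \<oplus> s \<otimes> (\<ominus> b 0)"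
  define w where "w = inv v"
  have v: "v \<noteq> \<zero>" "w \<in> M" using one_plus_unit[of "\<ominus> b 0"] ME(5) by (auto simp: v_def w_def)
  have [simp]: "v \<in> carrier R" by (simp add: v_def)
  have vw: "w \<otimes> v = \<one>" using inv_props[of v] v by (simp add: w_def)
  have wr: "w \<otimes> r = horner k (\<lambda>i. w \<otimes> b (Suc i)) y"
    using v(2) by (simp add: r_def horner_scale)
  have "\<one> = s \<otimes> b 0 \<oplus> s \<otimes> (y \<otimes> r)"
    using b(2) by (simp add: k r_def r_distr)
  then have "v = (s \<otimes> b 0 \<oplus> s \<otimes> (y \<otimes> r)) \<oplus> \<ominus> (s \<otimes> b 0)"
    by (simp add: v_def r_minus)
  also have "\<dots> = s \<otimes> (y \<otimes> r)"
    using r_neg1[of "s \<otimes> b 0" "s \<otimes> (y \<otimes> r)"] by (simp add: a_ac)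
  finally have "v = s \<otimes> (y \<otimes> r)" .
  then have "\<one> = w \<otimes> (s \<otimes> (y \<otimes> r))" using vw by simp
  also have "\<dots> = s \<otimes> (y \<otimes> (w \<otimes> r))" using v(2) by (simp add: m_ac)
  finally have one: "\<one> = s \<otimes> (y \<otimes> horner k (\<lambda>i. w \<otimes> b (Suc i)) y)" by (simp only: wr)
  have wb: "w \<otimes> b (Suc i) \<in> M" for i using v(2) ME(6) by simp
  obtain e where e: "\<And>i. e i \<in> M" "x [^] k \<otimes> (y \<otimes> horner k (\<lambda>i. w \<otimes> b (Suc i)) y) = horner k e x"
    using horner_rev[OF M xy, of "\<lambda>i. w \<otimes> b (Suc i)" k] wb by blast
  obtain f where f: "\<And>i. f i \<in> M" "x [^] (l - k) \<otimes> horner k e x = horner ((l - k) + k) f x"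
    using horner_times_power[OF M xy(1), of e "l - k" k] e(1) by blast
  have xl: "x [^] l = s \<otimes> horner l f x"
  proof -
    have "x [^] l = x [^] (l - k) \<otimes> (x [^] k \<otimes> \<one>)" using l(2) by (simp add: nat_pow_mult)
    also have "\<dots> = x [^] (l - k) \<otimes> (x [^] k \<otimes> (s \<otimes> (y \<otimes> horner k (\<lambda>i. w \<otimes> b (Suc i)) y)))"
      using one by simp
    also have "\<dots> = s \<otimes> (x [^] (l - k) \<otimes> (x [^] k \<otimes> (y \<otimes> horner k (\<lambda>i. w \<otimes> b (Suc i)) y)))"
      using wb by (simp add: m_lcomm)
    also have "\<dots> = s \<otimes> horner l f x" using f(2) e(2) l(2) by simp
    finally show ?thesis .
  qed
  have fM [simp]: "f i \<in> carrier R" for i using f(1) by simp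
  define c where "c i = a i \<oplus> (a l \<otimes> s) \<otimes> f i" for i
  have "\<forall>i. c i \<in> M" using ME(6,7) f(1) by (simp add: c_def)
  moreover have "horner n a x = horner l c x"
  proof -
    have "horner n a x = horner l a x \<oplus> a l \<otimes> x [^] l" unfolding l(1) by (rule horner_snoc) simp_all
    also have "a l \<otimes> x [^] l = (a l \<otimes> s) \<otimes> horner l f x" by (simp add: xl m_assoc)
    also have "\<dots> = horner l (\<lambda>i. (a l \<otimes> s) \<otimes> f i) x" by (simp add: horner_scale)
    also have "horner l a x \<oplus> \<dots> = horner l c x" unfolding c_def by (simp add: horner_add)
    finally show ?thesis .
  qed
  ultimately show ?thesis using a(2) l(1) by (intro exI[of _ l]) auto
qed

lemma degree_descent:
  assumes xy: "x \<in> carrier R" "y \<in> carrier R" "x \<otimes> y = \<one>"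
    and a: "\<And>i. a i \<in> M" "\<one> = s \<otimes> horner n a x"
    and b: "\<And>i. b i \<in> M" "\<one> = s \<otimes> horner m b y"
  shows False
  using a b
proof (induction "n + m" arbitrary: n m a b rule: less_induct)
  case less
  show False
  proof (cases "m \<le> n")
    case True
    obtain n' c where "n' < n" "\<forall>i. c i \<in> M" "\<one> = s \<otimes> horner n' c x"
      using degree_reduction[OF xy less.prems True] by blast
    then show False using less.hyps[of n' m c b] less.prems by auto
  next
    case False
    have yx: "y \<otimes> x = \<one>" using xy m_comm by simp
    obtain m' c where "m' < m" "\<forall>i. c i \<in> M" "\<one> = s \<otimes> horner m' c y"
      using degree_reduction[OF xy(2,1) yx less.prems(3,4,1,2)] False by auto
    then show False using less.hyps[of n m' a c] less.prems by auto
  qed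
qed

text \<open>
  If neither \<open>x\<close> nor \<open>1/x\<close> were in \<open>M\<close>, then \<open>u\<close> would be in \<open>M[x]\<close> and in \<open>M[1/x]\<close>, and the two
  relations that express this would reduce each other's degree for ever.
\<close>

lemma valuation_property:
  assumes "x \<in> carrier R" "x \<noteq> \<zero>"
  shows "x \<in> M \<or> inv x \<in> M"
proof (rule ccontr)
  assume neg: "\<not> (x \<in> M \<or> inv x \<in> M)"
  have ex: "\<exists>n a. (\<forall>i. a i \<in> M) \<and> \<one> = s \<otimes> horner n a z" if z: "z \<in> carrier R" "z \<notin> M" for z
  proof -
    have "M \<subset> simple_extension M z"
      using simple_extension_incl[OF subringE(1)[OF M] z(1)] simple_extension_mem[OF M z(1)] z(2)
      by blast
    then have "u \<in> simple_extension M z"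
      using max simple_extension_is_subring[OF M z(1)] by blast
    then obtain n c where "\<forall>i. c i \<in> M" "u = horner n c z"
      unfolding simple_extension_horner[OF M z(1)] by blast
    then show ?thesis using u(2) by metis
  qed
  note x = inv_props[OF assms]
  obtain n a m b where "\<forall>i. a i \<in> M" "\<one> = s \<otimes> horner n a x" "\<forall>i. b i \<in> M" "\<one> = s \<otimes> horner m b (inv x)"
    using ex[OF assms(1)] ex[OF x(1)] neg by blast
  then show False using degree_descent[OF assms(1) x(1,2)] by blast
qed

end

section \<open>Uncountable fields have infinitely many maximal subrings\<close>

text \<open>
  If \<open>u\<close> were a polynomial in \<open>s\<close>, then \<open>s u - 1 = 0\<close> would be an algebraic relation with constant term
  \<open>-1\<close>.
\<close>

lemma transc_inv_notin:
  assumes "subring A R" "s \<in> carrier R" "transc A s" "u \<in> carrier R" "s \<otimes> u = \<one>"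
  shows "u \<notin> simple_extension A s"
proof
  note A = subringE[OF assms(1)]
  assume "u \<in> simple_extension A s"
  then obtain n c where c: "\<forall>i. c i \<in> A" "u = horner n c s"
    unfolding simple_extension_horner[OF assms(1,2)] by blast
  have "horner (Suc n) (case_nat (\<ominus> \<one>) c) s = \<zero>"
    using assms(2,5) c A(1) by (auto simp: l_neg)
  moreover have "\<forall>i. case_nat (\<ominus> \<one>) c i \<in> A" using c(1) A(3,5) by (auto split: nat.splits)
  ultimately have "case_nat (\<ominus> \<one>) c 0 = \<zero>" using assms(3) unfolding transc_def by blast
  then show False by (simp add: add.inv_eq_1_iff)
qed

text \<open>
  The exchange property: an algebraic relation of \<open>s\<close> with coefficients in \<open>A[y]\<close> is a relation between
  \<open>s\<close> and \<open>y\<close>, and can be read as a relation of \<open>y\<close> with coefficients in \<open>A[s]\<close>.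
\<close>

lemma algebraic_exchange:
  assumes A: "subring A R" and s: "s \<in> carrier R"
    and y: "y \<in> carrier R" "\<not> transc (simple_extension A y) s"
  obtains K n :: nat and d i j where "\<And>j i. d j i \<in> A" "i < K" "j < n" "d j i \<noteq> \<zero>"
    "horner K (\<lambda>i. horner n (\<lambda>j. d j i) s) y = \<zero>"
proof -
  note AE = subringE[OF A]
  have "\<exists>n c. (\<forall>i. c i \<in> simple_extension A y) \<and> horner n c s = \<zero> \<and> (\<exists>i<n. c i \<noteq> \<zero>)"
    using y(2) unfolding transc_def by blast
  then obtain n c j where c: "\<forall>i. c i \<in> simple_extension A y" "horner n c s = \<zero>"
    and j: "j < n" "c j \<noteq> \<zero>"
    by blast
  have "\<forall>j. \<exists>N e. (\<forall>i. e i \<in> A) \<and> c j = horner N e y"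
    using c(1) unfolding simple_extension_horner[OF A y(1)] by blast
  then obtain N e where e: "\<And>j i. e j i \<in> A" "\<And>j. c j = horner (N j) (e j) y" by metis
  \<comment> \<open>A common bound for the lengths of the first \<open>n\<close> coefficients.\<close>
  define K where "K = sum N {..<n}"
  define d where "d j i = (if i < N j then e j i else \<zero>)" for j i
  have dA: "d j i \<in> A" for j i using e(1) AE(2) by (simp add: d_def)
  have [simp]: "e j i \<in> carrier R" "d j i \<in> carrier R" "s \<in> carrier R" "y \<in> carrier R" for j i
    using e(1) dA AE(1) s y by auto
  have pad: "horner K (d j) y = c j" if "j < n" for j
  proof -
    have "N j \<le> K" unfolding K_def using that by (intro member_le_sum) auto
    then show ?thesis using horner_pad[of "e j" y "N j" K] by (simp add: d_def[abs_def] e(2))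
  qed
  have "horner n (\<lambda>j. horner K (d j) y) s = \<zero>"
    using c(2) horner_cong[of n "\<lambda>j. horner K (d j) y" c s] pad by simp
  then have "horner K (\<lambda>i. horner n (\<lambda>j. d j i) s) y = \<zero>"
    using horner_swap[of d y s n K] by simp
  moreover have "\<exists>i<K. d j i \<noteq> \<zero>"
  proof (rule ccontr)
    assume "\<not> (\<exists>i<K. d j i \<noteq> \<zero>)"
    then have "horner K (d j) y = horner K (\<lambda>_. \<zero>) y" by (intro horner_cong) auto
    then show False using pad[OF j(1)] j(2) by simp
  qed
  ultimately obtain i where "i < K" "d j i \<noteq> \<zero>" "horner K (\<lambda>i. horner n (\<lambda>j. d j i) s) y = \<zero>" by blast
  then show thesis by (rule that[of d i K j n, OF dA _ j(1)])
qed

text \<open>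
  The point is that \<open>M\<close> and \<open>u\<close> generate everything. If \<open>x\<close> is not in \<open>M\<close>, then its inverse \<open>y\<close> is a
  nonunit of \<open>M\<close>, and the lowest terms of an algebraic relation of \<open>y\<close> over \<open>A[s]\<close>, first with
  respect to \<open>y\<close> and then with respect to \<open>s\<close>, show that \<open>y\<close> divides a power of \<open>s\<close> in \<open>M\<close>.
\<close>

lemma maximal_avoiding_is_maximal_subring:
  assumes A: "subring A R" and s: "s \<in> carrier R" "transc A s"
    and maxA: "\<And>T. subring T R \<Longrightarrow> A \<subset> T \<Longrightarrow> \<not> transc T s"
    and u: "u \<in> carrier R" "s \<otimes> u = \<one>"
    and M: "subring M R" "A \<subseteq> M" "s \<in> M" "u \<notin> M"
    and maxM: "\<And>T. subring T R \<Longrightarrow> M \<subset> T \<Longrightarrow> u \<in> T"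
  shows "maximal_subring M R"
proof -
  note ME = subringE[OF M(1)]
  note MC = subsetD[OF ME(1)]
  note [simp] = s(1) u(1)
  have us: "u \<otimes> s = \<one>" using u m_comm by simp
  have generate: "x \<in> T" if T: "subring T R" "M \<subseteq> T" "u \<in> T" and x: "x \<in> carrier R" for x T
  proof (cases "x \<in> M")
    case True
    then show ?thesis using T by blast
  next
    case False
    note TE = subringE[OF T(1)]
    have x0: "x \<noteq> \<zero>" using False ME(2) by blast
    define y where "y = inv x"
    note y = inv_props[OF x x0, folded y_def]
    note [simp] = x y(1)
    have yM: "y \<in> M" using valuation_property[OF M(1,3) u M(4) maxM x x0] False by (simp add: y_def)
    have y0: "y \<noteq> \<zero>" using y(2) x by auto
    have "y \<notin> A"
    proof
      assume "y \<in> A"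
      then have "inv y \<in> A" using maximal_transc_inv[OF A s(2,1) maxA _ y0] by blast
      moreover have "inv y = x" using y by (intro comm_inv_char) (auto simp: m_comm)
      ultimately show False using False M(2) by blast
    qed
    then have "A \<subset> simple_extension A y"
      using simple_extension_incl[OF subringE(1)[OF A] y(1)] simple_extension_mem[OF A y(1)] by blast
    then have "\<not> transc (simple_extension A y) s"
      using maxA simple_extension_is_subring[OF A y(1)] by blast
    then obtain K n d i j where d: "\<And>j i. d j i \<in> A" "i < K" "j < (n::nat)" "d j i \<noteq> \<zero>"
      "horner K (\<lambda>i. horner n (\<lambda>j. d j i) s) y = \<zero>"
      using algebraic_exchange[OF A s(1) y(1)] by metis
    define q where "q i = horner n (\<lambda>j. d j i) s" for i
    have qM: "q i \<in> M" for i
      unfolding q_def by (rule horner_in_subring[OF M(1) _ M(3)]) (use d(1) M(2) in auto)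
    have "q i \<noteq> \<zero>"
      using s(2)[unfolded transc_def, rule_format, of "\<lambda>j. d j i" n j] d(1,3,4) by (auto simp: q_def)
    then obtain k m where k: "q k \<noteq> \<zero>" "m \<in> M" "horner K q y = y [^] k \<otimes> (q k \<oplus> y \<otimes> m)"
      using horner_leading[of M q y i K] qM M(1) yM d(2) by blast
    have [simp]: "q k \<in> carrier R" "m \<in> carrier R" using MC qM k(2) by auto
    have "y [^] k \<otimes> (q k \<oplus> y \<otimes> m) = \<zero>" using k(3) d(5) by (simp add: q_def[abs_def])
    then have qk: "q k \<oplus> y \<otimes> m = \<zero>"
      using pow_nonzero[OF y0 y(1), of k] integral[of "y [^] k" "q k \<oplus> y \<otimes> m"] by simp
    have "\<exists>j<n. d j k \<noteq> \<zero>"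
    proof (rule ccontr)
      assume "\<not> (\<exists>j<n. d j k \<noteq> \<zero>)"
      then have "q k = horner n (\<lambda>_. \<zero>) s" unfolding q_def by (intro horner_cong) auto
      then show False using k(1) by simp
    qed
    then obtain l e where l: "d l k \<noteq> \<zero>" "e \<in> M" "q k = s [^] l \<otimes> (d l k \<oplus> s \<otimes> e)"
      using horner_leading[of M "\<lambda>j. d j k" s _ n] M d(1) unfolding q_def by blast
    define a where "a = d l k"
    have a: "a \<in> A" "a \<noteq> \<zero>" "a \<in> carrier R"
      using d(1) l(1) subringE(1)[OF A] by (auto simp: a_def)
    note b = inv_props[OF a(3,2)]
    have bM: "inv a \<in> M" using maximal_transc_inv[OF A s(2,1) maxA a(1,2)] M(2) by blast
    note [simp] = a(3) b(1) MC[OF l(2)]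
    define f where "f = inv a \<otimes> e"
    have f: "f \<in> M" "f \<in> carrier R" using bM l(2) ME(6) by (auto simp: f_def)
    define v where "v = \<one> \<oplus> s \<otimes> f"
    have v: "v \<noteq> \<zero>" "inv v \<in> M" "v \<in> carrier R"
      using one_plus_unit[OF M(1,3) u M(4) maxM f(1)] f by (auto simp: v_def)
    note iv = inv_props[OF v(3,1)]
    note [simp] = f(2) v(3) iv(1)
    have "a \<otimes> f = e" using b(2) by (simp add: f_def m_assoc[symmetric])
    \<comment> \<open>With the unit \<open>a\<close> of \<open>A\<close> taken out, \<open>1 + s f\<close> remains, so the factor beside \<open>s^l\<close> is a unit of \<open>M\<close>.\<close>
    then have av: "a \<oplus> s \<otimes> e = a \<otimes> v" by (simp add: v_def r_distr) (metis a(3) f(2) m_lcomm s(1))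
    have "s [^] l \<otimes> (a \<otimes> v) \<oplus> y \<otimes> m = \<zero>" using qk l(3) av by (simp add: a_def)
    then have "s [^] l \<otimes> (a \<otimes> v) = \<ominus> (y \<otimes> m)" by (intro sum_zero_eq_neg) auto
    then have "(s [^] l \<otimes> (a \<otimes> v)) \<otimes> (u [^] l \<otimes> (inv a \<otimes> inv v)) \<otimes> x =
        \<ominus> (y \<otimes> m) \<otimes> (u [^] l \<otimes> (inv a \<otimes> inv v)) \<otimes> x" by simp
    also have "(s [^] l \<otimes> (a \<otimes> v)) \<otimes> (u [^] l \<otimes> (inv a \<otimes> inv v)) \<otimes> x =
        (s [^] l \<otimes> u [^] l) \<otimes> ((a \<otimes> inv a) \<otimes> (v \<otimes> inv v)) \<otimes> x" by (simp add: m_ac)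
    also have "\<dots> = x" using b(2) iv(2) u(2) by (simp add: nat_pow_distrib[symmetric])
    also have "\<ominus> (y \<otimes> m) \<otimes> (u [^] l \<otimes> (inv a \<otimes> inv v)) \<otimes> x =
        (x \<otimes> y) \<otimes> ((\<ominus> m) \<otimes> (u [^] l \<otimes> (inv a \<otimes> inv v)))"
      by (simp add: l_minus r_minus) (simp add: m_ac)
    also have "\<dots> = (\<ominus> m) \<otimes> (u [^] l \<otimes> (inv a \<otimes> inv v))" using y(2) by simp
    finally have "x = (\<ominus> m) \<otimes> (u [^] l \<otimes> (inv a \<otimes> inv v))" .
    moreover have "(\<ominus> m) \<otimes> (u [^] l \<otimes> (inv a \<otimes> inv v)) \<in> T"
      using TE(5,6) T(2,3) k(2) bM v(2) pow_in_subring[OF T(1)] by (meson subsetD)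
    ultimately show ?thesis by simp
  qed
  have "T = M" if "subring T R" "M \<subseteq> T" "T \<noteq> carrier R" for T
    using maxM[of T] generate[of T] that subringE(1)[OF that(1)] by blast
  then show ?thesis
    unfolding maximal_subring_def using M(1,4) u(1) by blast
qed

text \<open>
  The last conjunct tells the maximal subrings for different shifts of \<open>s\<close> apart. It holds because \<open>c\<close>
  is a unit of the field \<open>A\<close>, so that \<open>s + c = c (1 + s / c)\<close> is a unit of \<open>M\<close>.
\<close>

lemma inv_shift_in_maximal_avoiding:
  assumes A: "subring A R" and s: "s \<in> carrier R" "transc A s"
    and maxA: "\<And>T. subring T R \<Longrightarrow> A \<subset> T \<Longrightarrow> \<not> transc T s"
  shows "\<exists>M. maximal_subring M R \<and> inv s \<notin> M \<and> (\<forall>c\<in>A. c \<noteq> \<zero> \<longrightarrow> inv (s \<oplus> c) \<in> M)"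
proof -
  note AE = subringE[OF A]
  have s0: "s \<noteq> \<zero>"
  proof
    assume "s = \<zero>"
    then have "horner (Suc (Suc 0)) (\<lambda>i. if i = 0 then \<zero> else \<one>) s = \<zero>" by simp
    moreover have "\<forall>i. (if i = (0::nat) then \<zero> else \<one>) \<in> A" using AE by simp
    ultimately have "(if Suc 0 = 0 then \<zero> else \<one>) = \<zero>"
      using s(2)[unfolded transc_def, rule_format, of "\<lambda>i. if i = 0 then \<zero> else \<one>" "Suc (Suc 0)" "Suc 0"]
      by blast
    then show False by simp
  qed
  define u where "u = inv s"
  note u = inv_props[OF s(1) s0, folded u_def]
  obtain M where M: "subring M R" "simple_extension A s \<subseteq> M" "u \<notin> M"
    and max: "\<And>T. subring T R \<Longrightarrow> M \<subset> T \<Longrightarrow> u \<in> T"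
    using ex_maximal_avoiding[OF simple_extension_is_subring[OF A s(1)] transc_inv_notin[OF A s u(1,2)]]
    by metis
  have AM: "A \<subseteq> M" "s \<in> M"
    using M(2) simple_extension_incl[OF AE(1) s(1)] simple_extension_mem[OF A s(1)] by auto
  have "inv (s \<oplus> c) \<in> M" if c: "c \<in> A" "c \<noteq> \<zero>" for c
  proof -
    have cc: "c \<in> carrier R" using c AE(1) by auto
    define b where "b = inv c"
    note b = inv_props[OF cc c(2), folded b_def]
    have bM: "b \<in> M" using maximal_transc_inv[OF A s(2,1) maxA c] AM(1) by (auto simp: b_def)
    define v where "v = \<one> \<oplus> s \<otimes> b"
    have v: "v \<noteq> \<zero>" "inv v \<in> M" "v \<in> carrier R"
      using one_plus_unit[OF M(1) AM(2) u(1,2) M(3) max bM] s(1) b(1) by (auto simp: v_def)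
    note iv = inv_props[OF v(3,1)]
    note [simp] = s(1) cc b(1) v(3) iv(1)
    have "c \<otimes> v = c \<oplus> s \<otimes> (c \<otimes> b)" by (simp add: v_def r_distr m_lcomm)
    then have sc: "s \<oplus> c = c \<otimes> v" using b(2) by (simp add: a_comm)
    have "(c \<otimes> v) \<otimes> (b \<otimes> inv v) = (c \<otimes> b) \<otimes> (v \<otimes> inv v)" by (simp add: m_ac)
    then have "inv (c \<otimes> v) = b \<otimes> inv v" using b(2) iv(2) by (intro comm_inv_char) auto
    then show ?thesis using sc subringE(6)[OF M(1) bM v(2)] by simp
  qed
  moreover have "maximal_subring M R"
    by (rule maximal_avoiding_is_maximal_subring[OF A s maxA u(1,2) M(1) AM M(3) max])
  ultimately show ?thesis using M(3) unfolding u_def by blast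
qed

text \<open>
  Each shift \<open>t + a\<close> is transcendental over exactly those subrings above \<open>A\<close> over which \<open>t\<close> is, so all
  shifts inherit the maximality of \<open>A\<close>. The maximal subring belonging to \<open>a\<close> is told apart from the
  others by the inverse of \<open>t + a\<close>.
\<close>

lemma infinite_maximal_subrings_of_transc:
  assumes A: "subring A R" "infinite A" and t: "t \<in> carrier R" "transc A t"
    and maxA: "\<And>T. subring T R \<Longrightarrow> A \<subset> T \<Longrightarrow> \<not> transc T t"
  shows "infinite (maximal_subrings R)"
proof -
  note AE = subringE[OF A(1)]
  note AC = subsetD[OF AE(1)]
  have "\<exists>M. maximal_subring M R \<and> inv (t \<oplus> a) \<notin> M \<and>
      (\<forall>c\<in>A. c \<noteq> \<zero> \<longrightarrow> inv (t \<oplus> a \<oplus> c) \<in> M)" if a: "a \<in> A" for a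
  proof (rule inv_shift_in_maximal_avoiding[OF A(1)])
    have [simp]: "a \<in> carrier R" "t \<in> carrier R" using a AC t by auto
    show "t \<oplus> a \<in> carrier R" by simp
    show "transc A (t \<oplus> a)" by (rule transc_shift[OF A(1) a t])
    fix T assume T: "subring T R" "A \<subset> T"
    show "\<not> transc T (t \<oplus> a)"
    proof
      assume tr: "transc T (t \<oplus> a)"
      have "\<ominus> a \<in> T" using AE(5)[OF a] T(2) by blast
      then have "transc T (t \<oplus> a \<oplus> \<ominus> a)" by (intro transc_shift[OF T(1) _ _ tr]) auto
      then show False using maxA[OF T] by (simp add: a_assoc r_neg)
    qed
  qed
  then obtain M where M: "\<And>a. a \<in> A \<Longrightarrow> maximal_subring (M a) R"
    "\<And>a. a \<in> A \<Longrightarrow> inv (t \<oplus> a) \<notin> M a"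
    "\<And>a c. a \<in> A \<Longrightarrow> c \<in> A \<Longrightarrow> c \<noteq> \<zero> \<Longrightarrow> inv (t \<oplus> a \<oplus> c) \<in> M a" by metis
  have "inj_on M A"
  proof (rule inj_onI, rule ccontr)
    fix a b assume ab: "a \<in> A" "b \<in> A" "M a = M b" "a \<noteq> b"
    have [simp]: "a \<in> carrier R" "b \<in> carrier R" "t \<in> carrier R" using ab AC t by auto
    have "b \<oplus> \<ominus> a \<in> A" using AE(5,7) ab by simp
    moreover have "b \<oplus> \<ominus> a \<noteq> \<zero>" using ab(4) r_right_minus_eq[of b a] by (auto simp: a_minus_def)
    ultimately have "inv (t \<oplus> a \<oplus> (b \<oplus> \<ominus> a)) \<in> M a" using M(3) ab by blast
    moreover have "t \<oplus> a \<oplus> (b \<oplus> \<ominus> a) = t \<oplus> b \<oplus> (a \<oplus> \<ominus> a)" by (simp add: a_ac)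
    then have "t \<oplus> a \<oplus> (b \<oplus> \<ominus> a) = t \<oplus> b" by (simp add: r_neg)
    ultimately show False using M(2)[OF ab(2)] ab(3) by simp
  qed
  then have "infinite (M ` A)" using A(2) finite_imageD by blast
  moreover have "M ` A \<subseteq> maximal_subrings R" using M(1) by (auto simp: maximal_subrings_def)
  ultimately show ?thesis using finite_subset by blast
qed

text \<open>
  A root is shifted to \<open>0\<close>, where it becomes a factor of the polynomial that can be split off.
\<close>

lemma finite_horner_roots:
  assumes "\<And>i. c i \<in> carrier R" "j < n" "c j \<noteq> \<zero>"
  shows "finite {x \<in> carrier R. horner n c x = \<zero>}"
  using assms
proof (induction n arbitrary: c j)
  case (Suc n)
  show ?case
  proof (cases "\<exists>r\<in>carrier R. horner (Suc n) c r = \<zero>")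
    case True
    then obtain r where r: "r \<in> carrier R" "horner (Suc n) c r = \<zero>" by blast
    obtain d where d: "\<And>i. d i \<in> carrier R" "d n = c n"
      "\<And>x. x \<in> carrier R \<Longrightarrow> horner (Suc n) c (x \<oplus> r) = horner (Suc n) d x"
      using horner_shift[OF carrier_is_subring r(1), of c n] Suc.prems(1) by blast
    have "horner (Suc n) c (\<zero> \<oplus> r) = d 0" using d by simp
    then have d0: "d 0 = \<zero>" using r by simp
    show ?thesis
    proof (cases "c n = \<zero>")
      case True
      then have "j < n" using Suc.prems by (metis less_SucE)
      then have "finite {x \<in> carrier R. horner n c x = \<zero>}" using Suc by blast
      moreover have "horner (Suc n) c x = horner n c x" if "x \<in> carrier R" for x
        using True that Suc.prems(1) by (simp add: horner_snoc del: horner.simps)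
      ultimately show ?thesis by (simp cong: conj_cong del: horner.simps)
    next
      case False
      then obtain k where k: "n = Suc k" using d(2) d0 by (cases n) auto
      have fin: "finite {x \<in> carrier R. horner n (\<lambda>i. d (Suc i)) x = \<zero>}"
        by (rule Suc.IH[of _ k]) (use d False k in auto)
      have "{x \<in> carrier R. horner (Suc n) c x = \<zero>} \<subseteq>
        insert r ((\<lambda>z. z \<oplus> r) ` {x \<in> carrier R. horner n (\<lambda>i. d (Suc i)) x = \<zero>})"
      proof
        fix x assume "x \<in> {x \<in> carrier R. horner (Suc n) c x = \<zero>}"
        then have x: "x \<in> carrier R" "horner (Suc n) c x = \<zero>" by auto
        define z where "z = x \<oplus> \<ominus> r"
        have z: "z \<in> carrier R" "x = z \<oplus> r" using x r by (simp_all add: z_def a_assoc l_neg)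
        have "z \<otimes> horner n (\<lambda>i. d (Suc i)) z = \<zero>"
          using d(3)[OF z(1)] d0 x(2) z d(1) by simp
        then have "z = \<zero> \<or> horner n (\<lambda>i. d (Suc i)) z = \<zero>"
          by (rule integral) (use z d(1) in auto)
        then show "x \<in> insert r ((\<lambda>z. z \<oplus> r) ` {x \<in> carrier R. horner n (\<lambda>i. d (Suc i)) x = \<zero>})"
          using z r by auto
      qed
      then show ?thesis using fin finite_subset by blast
    qed
  next
    case False
    then have "{x \<in> carrier R. horner (Suc n) c x = \<zero>} = {}" by blast
    then show ?thesis by (simp only: finite.emptyI)
  qed
qed simp

text \<open>
  There are only countably many polynomials over \<open>A\<close>, and each has finitely many roots.
\<close>

lemma countable_non_transc:
  assumes "subring A R" "countable A"
  shows "countable {t \<in> carrier R. \<not> transc A t}"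
proof -
  define c where "c l i = (if i < length l then l ! i else \<zero>)" for l i
  define Z where "Z l = {t \<in> carrier R. horner (length l) (c l) t = \<zero>}" for l
  have "{t \<in> carrier R. \<not> transc A t} \<subseteq> (\<Union>l \<in> {l \<in> lists A. \<exists>i<length l. l ! i \<noteq> \<zero>}. Z l)"
  proof
    fix t assume "t \<in> {t \<in> carrier R. \<not> transc A t}"
    then obtain n d i where t: "t \<in> carrier R" "\<forall>i. d i \<in> A" "horner n d t = \<zero>" "i < n" "d i \<noteq> \<zero>"
      unfolding transc_def by blast
    define l where "l = map d [0..<n]"
    have "horner (length l) (c l) t = horner n d t"
      by (auto simp: l_def c_def intro!: horner_cong)
    then have "t \<in> Z l" using t by (simp add: Z_def)
    moreover have "l \<in> {l \<in> lists A. \<exists>i<length l. l ! i \<noteq> \<zero>}"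
      using t by (auto simp: l_def in_lists_conv_set intro!: exI[of _ i])
    ultimately show "t \<in> (\<Union>l \<in> {l \<in> lists A. \<exists>i<length l. l ! i \<noteq> \<zero>}. Z l)" by blast
  qed
  moreover have "countable (Z l)" if "l \<in> {l \<in> lists A. \<exists>i<length l. l ! i \<noteq> \<zero>}" for l
  proof -
    from that obtain i where i: "i < length l" "l ! i \<noteq> \<zero>" "set l \<subseteq> A" by auto
    have "c l k \<in> carrier R" for k
      by (auto simp: c_def intro!: subsetD[OF subringE(1)[OF assms(1)]] subsetD[OF i(3)])
    then have "finite (Z l)" unfolding Z_def
      by (rule finite_horner_roots[of _ i]) (use i in \<open>auto simp: c_def\<close>)
    then show ?thesis by (rule countable_finite)
  qed
  moreover have "countable {l \<in> lists A. \<exists>i<length l. l ! i \<noteq> \<zero>}"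
    using countable_lists[OF assms(2)] by (rule countable_subset[rotated]) auto
  ultimately show ?thesis using countable_UN countable_subset by (metis (no_types, lifting))
qed

lemma countable_subring_hull:
  assumes "C \<subseteq> carrier R" "countable C"
  shows "\<exists>A. subring A R \<and> C \<subseteq> A \<and> countable A"
proof -
  define step where "step B = B \<union> a_inv R ` B \<union> case_prod (\<otimes>) ` (B \<times> B) \<union> case_prod (\<oplus>) ` (B \<times> B)" for B
  define G where "G n = (step ^^ n) (insert \<one> C)" for n
  have G_Suc: "G (Suc n) = step (G n)" for n by (simp add: G_def)
  have mono: "G m \<subseteq> G n" if "m \<le> n" for m n
    using that by (induction n rule: dec_induct) (auto simp: G_Suc step_def)
  have carr: "G n \<subseteq> carrier R" for n
    by (induction n) (use assms in \<open>auto simp: G_Suc step_def, auto simp: G_def\<close>)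
  have count: "countable (G n)" for n
    by (induction n) (use assms in \<open>auto simp: G_Suc step_def intro!: countable_SIGMA, auto simp: G_def\<close>)
  have "subring (\<Union>n. G n) R"
  proof (rule subringI)
    show "(\<Union>n. G n) \<subseteq> carrier R" using carr by blast
    have "\<one> \<in> G 0" by (simp add: G_def)
    then show "\<one> \<in> (\<Union>n. G n)" by blast
    fix h assume "h \<in> (\<Union>n. G n)"
    then obtain n where n: "h \<in> G n" by blast
    then have "\<ominus> h \<in> G (Suc n)" by (simp add: G_Suc step_def)
    then show "\<ominus> h \<in> (\<Union>n. G n)" by blast
    fix k assume "k \<in> (\<Union>n. G n)"
    then obtain m where m: "k \<in> G m" by blast
    have hk: "h \<in> G (max n m)" "k \<in> G (max n m)" using n m mono[of n "max n m"] mono[of m "max n m"] by auto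
    have "h \<otimes> k \<in> G (Suc (max n m))" "h \<oplus> k \<in> G (Suc (max n m))"
      unfolding G_Suc step_def using hk by (auto intro!: image_eqI[of _ _ "(h, k)"])
    then show "h \<otimes> k \<in> (\<Union>n. G n)" "h \<oplus> k \<in> (\<Union>n. G n)" by blast+
  qed
  moreover have "C \<subseteq> G 0" by (auto simp: G_def)
  ultimately show ?thesis using count by (intro exI[of _ "\<Union>n. G n"]) auto
qed

theorem uncountable_imp_infinite_maximal_subrings:
  assumes "uncountable (carrier R)"
  shows "infinite (maximal_subrings R)"
proof -
  have "infinite (carrier R)" using assms countable_finite by blast
  then obtain C where C: "C \<subseteq> carrier R" "countable C" "infinite C"
    using infinite_countable_subset' by metis
  then obtain A where A: "subring A R" "C \<subseteq> A" "countable A" using countable_subring_hull by metis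
  have "carrier R \<noteq> {t \<in> carrier R. \<not> transc A t}" using countable_non_transc[OF A(1,3)] assms by metis
  then obtain t where t: "t \<in> carrier R" "transc A t" by blast
  obtain B where "subring B R" "A \<subseteq> B" "transc B t" "\<And>T. subring T R \<Longrightarrow> B \<subset> T \<Longrightarrow> \<not> transc T t"
    using ex_maximal_transc[OF A(1) t(2)] by metis
  moreover have "infinite B" using C(3) A(2) \<open>A \<subseteq> B\<close> by (meson finite_subset)
  ultimately show ?thesis using infinite_maximal_subrings_of_transc t(1) by metis
qed

end

section \<open>The finite subfields of an algebraic closure of the field with two elements\<close>

type_synonym F2bar = "gf2 alg_closure"

abbreviation F2bar_ring :: "F2bar ring" where
  "F2bar_ring \<equiv> ring_of_type_algebra"

lemma CHAR_F2bar: "CHAR(F2bar) = 2"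
proof -
  have "(1 :: gf2) + 1 = 0" by transfer simp
  then have "of_nat 2 = (0 :: gf2)" by simp
  moreover have "\<And>n. n < 2 \<Longrightarrow> 0 < n \<Longrightarrow> of_nat n \<noteq> (0 :: gf2)"
    by (auto simp: less_2_cases_iff)
  ultimately have "CHAR(gf2) = 2" by (intro CHAR_eq_posI) auto
  then show ?thesis by simp
qed

lemma F2bar_double: "x + x = (0 :: F2bar)"
proof -
  have "of_nat 2 = (0 :: F2bar)" using of_nat_CHAR[where ?'a = F2bar] unfolding CHAR_F2bar .
  then have "(1 + 1) * x = 0" by simp
  then show ?thesis by (simp only: distrib_right mult_1)
qed

lemma F2bar_uminus: "- x = (x :: F2bar)"
  using F2bar_double[of x] by (rule minus_unique)

lemma frob_add: "(x + y :: F2bar) ^ (2 ^ n) = x ^ (2 ^ n) + y ^ (2 ^ n)"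
  by (rule freshmans_dream'[of "2 ^ n" n]) (unfold CHAR_F2bar, simp_all)

lemma frob_sum: "(\<Sum>i\<in>A. f i :: F2bar) ^ (2 ^ n) = (\<Sum>i\<in>A. f i ^ (2 ^ n))"
  by (rule freshmans_dream_sum'[of "2 ^ n" n]) (unfold CHAR_F2bar, simp_all)

text \<open>
  In characteristic two every element is its own negative.
\<close>

lemma subring_F2bar:
  "subring T F2bar_ring \<longleftrightarrow> 1 \<in> T \<and> (\<forall>x\<in>T. \<forall>y\<in>T. x + y \<in> T \<and> x * y \<in> T)" (is "?L = ?R")
proof
  interpret R: ring F2bar_ring by (rule ring_from_type_algebra)
  have um: "\<ominus>\<^bsub>F2bar_ring\<^esub> x = x" for x
    by (rule R.minus_equality) (simp_all add: ring_of_type_algebra_def F2bar_double)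
  show "?R \<Longrightarrow> ?L"
    by (rule R.subringI) (simp_all add: um, simp_all add: ring_of_type_algebra_def)
  show "?L \<Longrightarrow> ?R"
    using subringE[of T F2bar_ring] by (simp add: ring_of_type_algebra_def)
qed

text \<open>
  The fixed points of the \<open>n\<close>-th power of the Frobenius map form the field with \<open>2^n\<close> elements. For
  \<open>n = 0\<close> this is the whole closure, in accordance with \<open>0\<close> being the largest element of the
  divisibility order.
\<close>

definition frob_fix :: "nat \<Rightarrow> F2bar set" where
  "frob_fix n = {x. x ^ (2 ^ n) = x}"

lemma frob_fix_subring: "subring (frob_fix n) F2bar_ring"
  by (auto simp: subring_F2bar frob_fix_def frob_add power_mult_distrib)

lemma frob_fix_1_iff: "x \<in> frob_fix 1 \<longleftrightarrow> x = 0 \<or> x = 1"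
proof -
  have "x \<in> frob_fix 1 \<longleftrightarrow> x * x = x * 1" by (simp add: frob_fix_def power2_eq_square)
  then show ?thesis unfolding mult_cancel_left .
qed

lemma frob_fix_dvd_mono: "m dvd n \<Longrightarrow> frob_fix m \<subseteq> frob_fix n"
proof (elim dvdE, intro subsetI)
  fix x k assume x: "x \<in> frob_fix m" "n = m * k"
  have "x ^ (2 ^ (m * k)) = x"
    using x(1) by (induction k) (simp_all add: frob_fix_def power_add power_mult)
  then show "x \<in> frob_fix n" using x(2) by (simp add: frob_fix_def)
qed

lemma frob_fix_gcd:
  assumes "x \<in> frob_fix m" "x \<in> frob_fix n"
  shows "x \<in> frob_fix (gcd m n)"
proof (cases "m = 0")
  case False
  then obtain a b where ab: "m * a = n * b + gcd m n" using bezout_nat by blast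
  have "x ^ (2 ^ (n * b)) = x" using frob_fix_dvd_mono[of n "n * b"] assms(2) by (auto simp: frob_fix_def)
  moreover have "x ^ (2 ^ (m * a)) = x" using frob_fix_dvd_mono[of m "m * a"] assms(1) by (auto simp: frob_fix_def)
  ultimately show ?thesis unfolding ab by (simp add: frob_fix_def power_add power_mult)
qed (use assms in simp)

text \<open>
  The degree over the field with two elements, which equals the length of the orbit under the
  Frobenius map.
\<close>

definition frob_degree :: "F2bar \<Rightarrow> nat" where
  "frob_degree x = (LEAST d. d > 0 \<and> x \<in> frob_fix d)"

lemma
  assumes "x \<in> frob_fix n" "n > 0"
  shows frob_degree_pos: "frob_degree x > 0"
    and frob_degree_fix: "x \<in> frob_fix (frob_degree x)"
    and frob_degree_dvd: "x \<in> frob_fix m \<Longrightarrow> frob_degree x dvd m"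
proof -
  let ?d = "frob_degree x"
  have d: "?d > 0 \<and> x \<in> frob_fix ?d"
    unfolding frob_degree_def by (rule LeastI[of _ n]) (use assms in simp)
  then show "?d > 0" "x \<in> frob_fix ?d" by auto
  assume "x \<in> frob_fix m"
  then have "x \<in> frob_fix (gcd ?d m)" using frob_fix_gcd d by blast
  then have "?d \<le> gcd ?d m" unfolding frob_degree_def[of x]
    by (intro Least_le) (use d in \<open>auto simp: frob_degree_def\<close>)
  then have "gcd ?d m = ?d" using d by (meson dvd_imp_le gcd_dvd1 le_antisym)
  then show "?d dvd m" by (metis gcd_dvd2)
qed

abbreviation frob_poly :: "nat \<Rightarrow> F2bar poly" where
  "frob_poly n \<equiv> Polynomial.monom 1 (2 ^ n) - Polynomial.monom 1 1"

lemma degree_frob_poly: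
  assumes "n > 0" shows "Polynomial.degree (frob_poly n) = 2 ^ n"
proof -
  have "(1::nat) < 2 ^ n" using assms one_less_power[of "2::nat" n] by simp
  then have "Polynomial.degree (- Polynomial.monom (1::F2bar) 1) < Polynomial.degree (Polynomial.monom (1::F2bar) (2 ^ n))"
    by (simp add: Polynomial.degree_monom_eq)
  then show ?thesis
    using Polynomial.degree_add_eq_left[of "- Polynomial.monom (1::F2bar) 1" "Polynomial.monom (1::F2bar) (2 ^ n)"]
    by (simp add: Polynomial.degree_monom_eq)
qed

lemma frob_fix_roots: "frob_fix n = {x. poly (frob_poly n) x = 0}"
  by (auto simp: frob_fix_def poly_monom)

lemma pderiv_frob_poly:
  assumes "n > 0" shows "pderiv (frob_poly n) = [:-1:]"
proof -
  have "of_nat (2 ^ n) = (0 :: F2bar)"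
    using assms unfolding of_nat_eq_0_iff_char_dvd CHAR_F2bar by simp
  then have "pderiv (Polynomial.monom (1 :: F2bar) (2 ^ n)) = 0" by (simp add: pderiv_monom)
  moreover have "pderiv (Polynomial.monom (1 :: F2bar) 1) = [:1:]"
    by (simp add: pderiv_monom monom_0)
  ultimately show ?thesis by (simp add: pderiv_diff)
qed

text \<open>
  The polynomial \<open>X^(2^n) - X\<close> splits over the closure, and it has no multiple roots because its
  derivative is \<open>-1\<close>.
\<close>

lemma finite_frob_fix: "n > 0 \<Longrightarrow> finite (frob_fix n)"
  and card_frob_fix: "n > 0 \<Longrightarrow> card (frob_fix n) = 2 ^ n"
proof -
  assume n: "n > 0"
  let ?p = "frob_poly n"
  have p0: "?p \<noteq> 0" using degree_frob_poly[OF n] by auto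
  show fin: "finite (frob_fix n)" unfolding frob_fix_roots using p0 by (rule poly_roots_finite)
  obtain A where A: "size A = Polynomial.degree ?p"
    "?p = smult (lead_coeff ?p) (\<Prod>x\<in>#A. [:-x, 1:])"
    using alg_closed_imp_factorization[OF p0] by blast
  have "Multiset.count A x \<le> 1" for x
  proof (rule ccontr)
    assume "\<not> Multiset.count A x \<le> 1"
    then have "{#x, x#} \<subseteq># A" by (simp add: subseteq_mset_def)
    then obtain B where B: "A = {#x, x#} + B" by (metis subset_mset.le_iff_add)
    define q where "q = smult (lead_coeff ?p) (\<Prod>x\<in>#B. [:-x, 1:])"
    have q: "?p = [:-x, 1:] * ([:-x, 1:] * q)"
      by (subst A(2)) (simp only: B q_def image_mset_union prod_mset.union image_mset_add_mset
        prod_mset.add_mset image_mset_empty prod_mset.empty mult_smult_right mult_1_right mult.assoc)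
    have "poly (pderiv ?p) x = 0" unfolding q pderiv_mult poly_add poly_mult by simp
    then show False unfolding pderiv_frob_poly[OF n] by simp
  qed
  then have "size A = card (set_mset A)"
    unfolding size_multiset_overloaded_eq
    by (metis (no_types, lifting) One_nat_def card_eq_sum count_greater_zero_iff le_antisym less_eq_Suc_le sum.cong)
  also have "set_mset A = frob_fix n"
  proof -
    have "lead_coeff ?p \<noteq> 0" using p0 unfolding leading_coeff_0_iff .
    then have "poly ?p x = 0 \<longleftrightarrow> x \<in># A" for x
      by (subst A(2)) (simp add: poly_prod_mset prod_mset_zero_iff image_iff eq_neg_iff_add_eq_0)
    then show ?thesis unfolding frob_fix_roots by auto
  qed
  finally show "card (frob_fix n) = 2 ^ n" using A(1) degree_frob_poly[OF n] by simp
qed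

lemma subring_powers:
  assumes "subring T F2bar_ring" "x \<in> T" shows "x ^ i \<in> T"
  using assms by (induction i) (auto simp: subring_F2bar)

lemma subring_sum:
  assumes T: "subring T F2bar_ring" and "\<And>i. i \<in> A \<Longrightarrow> f i \<in> T"
  shows "sum f A \<in> T"
proof -
  have "0 \<in> T" using subringE(2)[OF T] by (simp add: ring_of_type_algebra_def)
  then show ?thesis
    using assms by (induction A rule: infinite_finite_induct) (auto simp: subring_F2bar)
qed

text \<open>
  A coincidence among the conjugates would make the orbit of \<open>x\<close> under the Frobenius map too short.
\<close>

lemma frob_conjugates_distinct:
  assumes "x \<in> frob_fix n" "n > 0"
  shows "inj_on (\<lambda>j. x ^ (2 ^ j)) {..<frob_degree x}"
proof -
  let ?d = "frob_degree x"
  note d = frob_degree_pos[OF assms] frob_degree_fix[OF assms]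
  have neq: "x ^ (2 ^ j) \<noteq> x ^ (2 ^ k)" if jk: "j < k" "k < ?d" for j k
  proof
    assume eq: "x ^ (2 ^ j) = x ^ (2 ^ k)"
    have "x ^ (2 ^ (j + (?d - k))) = (x ^ (2 ^ j)) ^ (2 ^ (?d - k))" by (simp add: power_add power_mult)
    also have "\<dots> = x ^ (2 ^ (k + (?d - k)))" unfolding eq by (simp add: power_add power_mult)
    also have "\<dots> = x" using jk d by (simp add: frob_fix_def)
    finally have "x \<in> frob_fix (j + (?d - k))" by (simp add: frob_fix_def)
    then have "?d dvd j + (?d - k)" using frob_degree_dvd[OF assms] by blast
    then show False using jk by (auto dest!: dvd_imp_le)
  qed
  show ?thesis
    by (rule linorder_inj_onI) (use neq in auto)
qed

text \<open>
  Let \<open>d\<close> be the degree of \<open>x\<close>. The sums of \<open>a\<^sub>i x^i\<close> for \<open>i < d\<close> with all \<open>a\<^sub>i\<close> in \<open>{0, 1}\<close> lie in \<open>T\<close>,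
  and they are pairwise different: polynomials with such coefficients that agree at \<open>x\<close> also agree at
  its \<open>d\<close> conjugates. So there are \<open>2^d\<close> of them, which is all of the field with \<open>2^d\<close> elements.
\<close>

lemma frob_fix_subset_subring:
  assumes x: "x \<in> frob_fix n" "n > 0" and T: "subring T F2bar_ring" "x \<in> T"
  shows "frob_fix (frob_degree x) \<subseteq> T"
proof -
  let ?d = "frob_degree x"
  note d = frob_degree_pos[OF x] frob_degree_fix[OF x]
  define B where "B = {..<?d} \<rightarrow>\<^sub>E {0, 1 :: F2bar}"
  define p where "p a = (\<Sum>i<?d. Polynomial.monom (a i) i)" for a :: "nat \<Rightarrow> F2bar"
  have coeff_p: "Polynomial.coeff (p a) i = (if i < ?d then a i else 0)" for a i
    by (simp add: p_def coeff_sum)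
  have deg_p: "Polynomial.degree (p a) < ?d" for a
    by (rule degree_lessI) (use d in \<open>auto simp: coeff_p\<close>)
  have poly_p: "poly (p a) (x ^ (2 ^ j)) = poly (p a) x ^ (2 ^ j)" if "a \<in> B" for a j
  proof -
    have "a i ^ (2 ^ j) = a i" if "i < ?d" for i
      using \<open>a \<in> B\<close> that by (auto simp: B_def PiE_def Pi_def power_0_left)
    then have "(\<Sum>i<?d. a i * x ^ i) ^ (2 ^ j) = (\<Sum>i<?d. a i * (x ^ i) ^ (2 ^ j))"
      unfolding frob_sum by (intro sum.cong) (auto simp: power_mult_distrib)
    then show ?thesis by (simp add: p_def poly_sum poly_monom power_mult[symmetric] mult.commute)
  qed
  have inj: "inj_on (\<lambda>a. poly (p a) x) B"
  proof (rule inj_onI)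
    fix a b assume ab: "a \<in> B" "b \<in> B" "poly (p a) x = poly (p b) x"
    let ?C = "(\<lambda>j. x ^ (2 ^ j)) ` {..<?d}"
    have "card ?C = ?d" using frob_conjugates_distinct[OF x] by (simp add: card_image)
    then have "p a = p b"
      using deg_p by (intro poly_eqI_degree[of ?C]) (auto simp: poly_p ab)
    then have "a i = b i" if "i < ?d" for i using coeff_p[of a i] coeff_p[of b i] that by simp
    then show "a = b" using ab(1,2) unfolding B_def by (intro PiE_ext) auto
  qed
  have coeff_mem: "a i \<in> T \<inter> frob_fix ?d" if "a \<in> B" "i < ?d" for a i
  proof -
    have "a i = 0 \<or> a i = 1" using that by (auto simp: B_def PiE_def Pi_def)
    moreover have "0 \<in> T" "1 \<in> T" using subringE(2,3)[OF T(1)] by (simp_all add: ring_of_type_algebra_def)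
    ultimately show ?thesis by (auto simp: frob_fix_def power_0_left)
  qed
  have sub: "(\<lambda>a. poly (p a) x) ` B \<subseteq> T'" if T': "subring T' F2bar_ring" "x \<in> T'" "T \<inter> frob_fix ?d \<subseteq> T'" for T'
  proof
    fix y assume "y \<in> (\<lambda>a. poly (p a) x) ` B"
    then obtain a where a: "a \<in> B" "y = (\<Sum>i<?d. a i * x ^ i)"
      by (auto simp: p_def poly_sum poly_monom)
    have mem: "a i * x ^ i \<in> T'" if "i < ?d" for i
    proof -
      have "a i \<in> T'" using coeff_mem[OF a(1) that] T'(3) by (rule subsetD[rotated])
      then show ?thesis using subring_powers[OF T'(1,2)] T'(1) by (simp add: subring_F2bar)
    qed
    show "y \<in> T'" unfolding a(2) by (rule subring_sum[OF T'(1)], rule mem) simp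
  qed
  have "card ((\<lambda>a. poly (p a) x) ` B) = card (frob_fix ?d)"
    using d by (simp add: card_image[OF inj] card_frob_fix) (simp add: B_def card_PiE numeral_2_eq_2)
  moreover have "(\<lambda>a. poly (p a) x) ` B \<subseteq> frob_fix ?d"
    using sub[OF frob_fix_subring] d(2) by simp
  ultimately have "(\<lambda>a. poly (p a) x) ` B = frob_fix ?d"
    using card_subset_eq finite_frob_fix[OF d(1)] by metis
  then show ?thesis using sub[OF T] by simp
qed

text \<open>
  A finite subring \<open>T\<close> is a field, so its multiplicative group has a generator \<open>x\<close>. The field
  generated by \<open>x\<close> contains \<open>T\<close> and is contained in it.
\<close>

lemma finite_subfield_generator:
  assumes T: "subring T F2bar_ring" and Tl: "T \<subseteq> frob_fix l" and l: "l > 0"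
  shows "\<exists>x\<in>T. T = frob_fix (frob_degree x)"
proof -
  interpret R: field F2bar_ring by (rule field_from_type_algebra)
  let ?T = "F2bar_ring\<lparr>carrier := T\<rparr>"
  have simps: "\<zero>\<^bsub>F2bar_ring\<^esub> = 0" "\<one>\<^bsub>F2bar_ring\<^esub> = 1" "carrier F2bar_ring = UNIV"
    "\<And>x y. x \<otimes>\<^bsub>F2bar_ring\<^esub> y = x * y" by (simp_all add: ring_of_type_algebra_def)
  have "subfield T F2bar_ring"
  proof (rule R.subfieldI'[OF T])
    fix k assume "k \<in> T - {\<zero>\<^bsub>F2bar_ring\<^esub>}"
    then have k: "k \<in> T" "k \<noteq> 0" by (auto simp: simps)
    \<comment> \<open>In a field with \<open>2^l\<close> elements the inverse of \<open>k\<close> is \<open>k^(2^l - 2)\<close>.\<close>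
    have l2: "2 ^ l = Suc (Suc (2 ^ l - 2))" using l self_le_power[of "2::nat" l] by simp
    have "k * (k * k ^ (2 ^ l - 2)) = k"
      using k(1) Tl l2 by (metis (mono_tags, lifting) frob_fix_def mem_Collect_eq power_Suc subsetD)
    then have "k * k ^ (2 ^ l - 2) = 1" using k(2) by simp
    then have "inv\<^bsub>F2bar_ring\<^esub> k = k ^ (2 ^ l - 2)"
      by (intro R.comm_inv_char) (simp_all add: simps)
    then show "inv\<^bsub>F2bar_ring\<^esub> k \<in> T" using subring_powers[OF T k(1)] by simp
  qed
  then interpret T: field ?T by (rule R.subfield_iff(2))
  have fin: "finite (carrier ?T)" using Tl finite_frob_fix[OF l] finite_subset by auto
  have pow: "x [^]\<^bsub>?T\<^esub> (i::nat) = x ^ i" for x i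
    by (induction i) (simp_all add: simps mult.commute)
  obtain a where a: "a \<in> T" "T - {0} = {a ^ i | i::nat. i \<in> UNIV}"
    using T.finite_field_mult_group_has_gen[OF fin] by (auto simp: nat_pow_mult_of pow simps)
  have al: "a \<in> frob_fix l" using a(1) Tl by blast
  note d = frob_degree_fix[OF al l]
  have F: "subring (frob_fix (frob_degree a)) F2bar_ring" by (rule frob_fix_subring)
  have "T \<subseteq> frob_fix (frob_degree a)"
  proof
    fix y assume "y \<in> T"
    then have "y = 0 \<or> (\<exists>i. y = a ^ i)" using a(2) by blast
    then show "y \<in> frob_fix (frob_degree a)"
      using subring_powers[OF F d] subringE(2)[OF F] by (auto simp: simps)
  qed
  then show ?thesis using frob_fix_subset_subring[OF al l T a(1)] a(1) by blast
qed

text \<open>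
  A generator of the multiplicative group has this property.
\<close>

lemma ex_frob_degree:
  assumes "n > 0" shows "\<exists>x\<in>frob_fix n. frob_degree x = n"
proof -
  obtain x where x: "x \<in> frob_fix n" "frob_fix n = frob_fix (frob_degree x)"
    using finite_subfield_generator[OF frob_fix_subring subset_refl assms] by (rule bexE)
  have "card (frob_fix n) = card (frob_fix (frob_degree x))" using x(2) by (rule arg_cong)
  then have "(2::nat) ^ n = 2 ^ frob_degree x"
    unfolding card_frob_fix[OF assms] card_frob_fix[OF frob_degree_pos[OF x(1) assms]] .
  then have "frob_degree x = n" by simp
  then show ?thesis using x(1) by blast
qed

lemma frob_fix_subset_imp_dvd:
  assumes "frob_fix m \<subseteq> frob_fix n" "m > 0" shows "m dvd n"
  using ex_frob_degree[OF assms(2)] frob_degree_dvd[OF _ assms(2)] assms(1) by blast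

section \<open>Subrings of unions of finite fields and ideals of the divisibility order\<close>

text \<open>
  An ideal of the positive integers ordered by divisibility describes a Steinitz number, namely as
  the set of its finite divisors.
\<close>

definition div_ideal :: "nat set \<Rightarrow> bool" where
  "div_ideal N \<longleftrightarrow> 1 \<in> N \<and> 0 \<notin> N \<and> (\<forall>n\<in>N. \<forall>d. d dvd n \<longrightarrow> d \<in> N) \<and> (\<forall>m\<in>N. \<forall>n\<in>N. lcm m n \<in> N)"

definition frob_union :: "nat set \<Rightarrow> F2bar set" where
  "frob_union N = (\<Union>n\<in>N. frob_fix n)"

lemma frob_union_subring:
  assumes "div_ideal N" shows "subring (frob_union N) F2bar_ring"
proof -
  have "1 \<in> frob_union N" using assms by (auto simp: div_ideal_def frob_union_def frob_fix_def)
  moreover have "x + y \<in> frob_union N \<and> x * y \<in> frob_union N" if "x \<in> frob_union N" "y \<in> frob_union N" for x y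
  proof -
    from that obtain m n where mn: "m \<in> N" "n \<in> N" "x \<in> frob_fix m" "y \<in> frob_fix n"
      by (auto simp: frob_union_def)
    then have "x \<in> frob_fix (lcm m n)" "y \<in> frob_fix (lcm m n)"
      using frob_fix_dvd_mono[of m "lcm m n"] frob_fix_dvd_mono[of n "lcm m n"] by auto
    then have "x + y \<in> frob_fix (lcm m n) \<and> x * y \<in> frob_fix (lcm m n)"
      using frob_fix_subring[of "lcm m n"] by (simp add: subring_F2bar)
    then show ?thesis using assms mn unfolding div_ideal_def frob_union_def by blast
  qed
  ultimately show ?thesis unfolding subring_F2bar by blast
qed

lemma frob_degree_in_ideal:
  assumes "div_ideal N" "x \<in> frob_union N"
  shows "frob_degree x \<in> N" "x \<in> frob_fix (frob_degree x)" "frob_degree x > 0"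
    "x \<in> frob_fix m \<Longrightarrow> frob_degree x dvd m"
proof -
  from assms(2) obtain n where n: "n \<in> N" "x \<in> frob_fix n" by (auto simp: frob_union_def)
  then have "n > 0" using assms(1) by (auto simp: div_ideal_def intro: gr0I)
  note d = frob_degree_fix[OF n(2) this] frob_degree_dvd[OF n(2) this] frob_degree_pos[OF n(2) this]
  show "frob_degree x \<in> N" using d(2)[OF n(2)] assms(1) n(1) unfolding div_ideal_def by blast
  show "x \<in> frob_fix (frob_degree x)" "frob_degree x > 0"
    "x \<in> frob_fix m \<Longrightarrow> frob_degree x dvd m" using d by auto
qed

text \<open>
  If \<open>n \<in> I\<close>, an element of degree \<open>n\<close> can lie in the larger union only if \<open>n\<close> divides an element
  of \<open>N\<close>.
\<close>

lemma frob_union_mono_iff: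
  assumes "div_ideal I" "div_ideal N"
  shows "frob_union I \<subseteq> frob_union N \<longleftrightarrow> I \<subseteq> N"
proof
  assume sub: "frob_union I \<subseteq> frob_union N"
  show "I \<subseteq> N"
  proof
    fix n assume n: "n \<in> I"
    then have "n > 0" using assms(1) by (auto simp: div_ideal_def intro: gr0I)
    then obtain x where x: "x \<in> frob_fix n" "frob_degree x = n" using ex_frob_degree by blast
    then have "x \<in> frob_union N" using sub n by (auto simp: frob_union_def)
    then show "n \<in> N" using frob_degree_in_ideal(1)[OF assms(2)] x(2) by blast
  qed
qed (auto simp: frob_union_def)

text \<open>
  The ideal consists of the \<open>n\<close> for which \<open>T\<close> contains the field with \<open>2^n\<close> elements. It is closed
  under least common multiples because the finite subring of \<open>T\<close> cut out by degree \<open>l = lcm m n\<close> is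
  one of these fields, and its degree is a multiple of both \<open>m\<close> and \<open>n\<close>.
\<close>

lemma subring_is_frob_union:
  assumes N: "div_ideal N" and T: "subring T F2bar_ring" "T \<subseteq> frob_union N"
  shows "\<exists>I. div_ideal I \<and> T = frob_union I"
proof -
  define I where "I = {n. n > 0 \<and> frob_fix n \<subseteq> T}"
  have deg: "frob_degree x \<in> I" if "x \<in> T" for x
  proof -
    have "x \<in> frob_union N" using that T(2) by blast
    note d = frob_degree_in_ideal[OF N this]
    show ?thesis using frob_fix_subset_subring[OF d(2,3) T(1) that] d(3) by (simp add: I_def)
  qed
  have "T = frob_union I"
  proof
    show "T \<subseteq> frob_union I"
    proof
      fix x assume x: "x \<in> T"
      then have "x \<in> frob_fix (frob_degree x)" using T(2) by (intro frob_degree_in_ideal(2)[OF N]) blast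
      then show "x \<in> frob_union I" using deg[OF x] unfolding frob_union_def by (rule UN_I[rotated])
    qed
  qed (auto simp: frob_union_def I_def)
  moreover have "div_ideal I"
    unfolding div_ideal_def
  proof (intro conjI ballI allI impI)
    have "frob_fix 1 \<subseteq> T"
    proof
      fix x assume "x \<in> frob_fix 1"
      then have "x = 0 \<or> x = 1" by (simp only: frob_fix_1_iff)
      then show "x \<in> T" using subringE(2,3)[OF T(1)] by (auto simp: ring_of_type_algebra_def)
    qed
    then show "1 \<in> I" by (simp add: I_def)
    show "0 \<notin> I" by (simp add: I_def)
    show "d \<in> I" if "n \<in> I" "d dvd n" for n d
      using that frob_fix_dvd_mono[of d n] by (auto simp: I_def intro: gr0I)
    fix m n assume mn: "m \<in> I" "n \<in> I"
    define l where "l = lcm m n"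
    have l: "l > 0" "m dvd l" "n dvd l" using mn by (auto simp: l_def I_def lcm_pos_nat)
    interpret R: ring F2bar_ring by (rule ring_from_type_algebra)
    have "subring (T \<inter> frob_fix l) F2bar_ring" by (rule R.subring_inter[OF T(1) frob_fix_subring])
    from finite_subfield_generator[OF this Int_lower2 l(1)]
    obtain x where x: "T \<inter> frob_fix l = frob_fix (frob_degree x)" by (rule bexE)
    have "frob_fix m \<subseteq> frob_fix (frob_degree x)" "frob_fix n \<subseteq> frob_fix (frob_degree x)"
      using mn frob_fix_dvd_mono[OF l(2)] frob_fix_dvd_mono[OF l(3)] unfolding x[symmetric] I_def by blast+
    then have "m dvd frob_degree x" "n dvd frob_degree x"
      using mn by (auto simp: I_def intro!: frob_fix_subset_imp_dvd)
    then have "l dvd frob_degree x" by (simp add: l_def)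
    then have "frob_fix l \<subseteq> frob_fix (frob_degree x)" by (rule frob_fix_dvd_mono)
    then show "lcm m n \<in> I" using x l(1) unfolding I_def l_def[symmetric] by blast
  qed
  ultimately show ?thesis by blast
qed

section \<open>Fields with exactly one maximal subring\<close>

text \<open>
  The Steinitz number \<open>2 \<Prod>q\<^sup>\<infinity>\<close>, where the product extends over the \<open>q \<in> S\<close>.
\<close>

definition steinitz :: "nat set \<Rightarrow> nat set" where
  "steinitz S = {n. n > 0 \<and> multiplicity 2 n \<le> 1 \<and> (\<forall>p. prime p \<longrightarrow> p dvd n \<longrightarrow> p = 2 \<or> p \<in> S)}"

lemma prime_dvd_lcm_iff:
  fixes p :: nat assumes "prime p"
  shows "p dvd lcm m n \<longleftrightarrow> p dvd m \<or> p dvd n"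
proof
  assume "p dvd lcm m n"
  then have "p dvd m * n" by (rule dvd_trans) (simp add: lcm_least)
  then show "p dvd m \<or> p dvd n" using assms prime_dvd_mult_iff by blast
next
  show "p dvd m \<or> p dvd n \<Longrightarrow> p dvd lcm m n" by auto
qed

lemma div_ideal_steinitz: "div_ideal (steinitz S)"
  unfolding div_ideal_def
proof (intro conjI ballI allI impI)
  show "1 \<in> steinitz S" by (auto simp: steinitz_def)
  show "0 \<notin> steinitz S" by (auto simp: steinitz_def)
  fix n assume n: "n \<in> steinitz S"
  then have n0: "n > 0" by (simp add: steinitz_def)
  show "d \<in> steinitz S" if "d dvd n" for d
  proof -
    have "multiplicity 2 d \<le> multiplicity 2 n"
      by (rule dvd_imp_multiplicity_le) (use that n0 in auto)
    then show ?thesis using n that dvd_pos_nat[OF n0 that] dvd_trans[OF _ that]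
      unfolding steinitz_def by auto
  qed
  fix m assume m: "m \<in> steinitz S"
  then have m0: "m > 0" by (simp add: steinitz_def)
  have "multiplicity 2 (lcm n m) = max (multiplicity 2 n) (multiplicity 2 m)"
    by (rule multiplicity_lcm) (use n0 m0 in auto)
  then show "lcm n m \<in> steinitz S"
    using m n by (auto simp: steinitz_def prime_dvd_lcm_iff lcm_pos_nat)
qed

lemma div_ideal_odd:
  assumes "div_ideal N" shows "div_ideal {n \<in> N. odd n}"
  using assms unfolding div_ideal_def
  by (auto simp: prime_dvd_lcm_iff dvd_trans)

definition maximal_subideal :: "nat set \<Rightarrow> nat set \<Rightarrow> bool" where
  "maximal_subideal I N \<longleftrightarrow> div_ideal I \<and> I \<subset> N \<and>
     (\<forall>J. div_ideal J \<and> I \<subseteq> J \<and> J \<subset> N \<longrightarrow> J = I)"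

lemma two_in_steinitz: "2 \<in> steinitz S"
proof -
  have "multiplicity 2 (2::nat) = 1" by (rule multiplicity_self) auto
  moreover have "p = 2" if "prime p" "p dvd (2::nat)" for p
    using that by (simp add: primes_dvd_imp_eq)
  ultimately show ?thesis by (auto simp: steinitz_def)
qed

lemma steinitz_even_split:
  assumes "n \<in> steinitz S" "even n"
  obtains m where "n = 2 * m" "odd m" "m \<in> steinitz S" "lcm 2 m = n"
proof -
  obtain m where m: "n = 2 * m" using assms(2) by auto
  have "n > 0" using assms(1) by (simp add: steinitz_def)
  then have "multiplicity 2 n = Suc (multiplicity 2 m)"
    unfolding m by (intro multiplicity_times_same) auto
  then have "multiplicity 2 m = 0" using assms(1) by (simp add: steinitz_def)
  then have "odd m" using \<open>n > 0\<close> m by (simp add: multiplicity_eq_zero_iff)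
  moreover have "m \<in> steinitz S" using div_ideal_steinitz assms(1) m unfolding div_ideal_def by (metis dvd_triv_right)
  moreover have "lcm 2 m = n" using \<open>odd m\<close> m by (simp add: lcm_coprime)
  ultimately show thesis using that m by blast
qed

text \<open>
  An ideal that contains the odd part and one even number contains \<open>2\<close>. Any other even \<open>n\<close> is the
  least common multiple of \<open>2\<close> and the odd number \<open>n / 2\<close>.
\<close>

lemma maximal_subideal_odd: "maximal_subideal {n \<in> steinitz S. odd n} (steinitz S)"
  unfolding maximal_subideal_def
proof (intro conjI allI impI)
  let ?O = "{n \<in> steinitz S. odd n}"
  show "div_ideal ?O" by (rule div_ideal_odd[OF div_ideal_steinitz])
  have "2 \<in> steinitz S - ?O" using two_in_steinitz by simp
  then show "?O \<subset> steinitz S" by blast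
  fix J assume J: "div_ideal J \<and> ?O \<subseteq> J \<and> J \<subset> steinitz S"
  show "J = ?O"
  proof (rule ccontr)
    assume "J \<noteq> ?O"
    then obtain n where n: "n \<in> J" "even n" using J by blast
    then have two: "2 \<in> J" using J unfolding div_ideal_def by blast
    have "n \<in> J" if n: "n \<in> steinitz S" for n
    proof (cases "even n")
      case True
      obtain m where m: "odd m" "m \<in> steinitz S" "lcm 2 m = n" using steinitz_even_split[OF n True] by metis
      then have "m \<in> J" using J by blast
      then show ?thesis using J two m(3) unfolding div_ideal_def by blast
    qed (use n J in auto)
    then show False using J by blast
  qed
qed

text \<open>
  If \<open>2 \<notin> I\<close>, then \<open>I\<close> is contained in the odd part, which is itself a proper subideal. Suppose that
  \<open>2 \<in> I\<close>, and let \<open>n\<close> be the least element of the whole ideal that is missing in \<open>I\<close>. It has a prime factor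
  \<open>p\<close>, and \<open>p \<in> S\<close> since \<open>n\<close> would otherwise be the least common multiple of \<open>2\<close> and \<open>n / 2\<close>. Raising
  the exponent of \<open>p\<close> by one gives an ideal that contains \<open>n\<close> but not \<open>p n\<close>, hence lies strictly
  between \<open>I\<close> and the whole ideal.
\<close>

lemma maximal_subideal_unique:
  assumes "maximal_subideal I (steinitz S)" and odd: "\<And>p. p \<in> S \<Longrightarrow> odd p"
  shows "I = {n \<in> steinitz S. odd n}"
proof (cases "2 \<in> I")
  case False
  have "I \<subseteq> {n \<in> steinitz S. odd n}" using assms(1) False unfolding maximal_subideal_def div_ideal_def by blast
  then show ?thesis using assms(1) maximal_subideal_odd unfolding maximal_subideal_def by (metis (no_types, lifting))
next
  case True
  note max = assms(1)[unfolded maximal_subideal_def]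
  have I: "div_ideal I" using max by blast
  note N = div_ideal_steinitz[of S]
  define n where "n = (LEAST n. n \<in> steinitz S - I)"
  have n: "n \<in> steinitz S" "n \<notin> I" using LeastI_ex[of "\<lambda>n. n \<in> steinitz S - I"] max unfolding n_def by blast+
  have least: "m \<in> I" if "m \<in> steinitz S" "m < n" for m
    using not_less_Least[of m "\<lambda>n. n \<in> steinitz S - I"] that unfolding n_def by blast
  have "n > 0" using n(1) by (simp add: steinitz_def)
  have "n \<noteq> 1" using n(2) I unfolding div_ideal_def by blast
  then obtain p where p: "prime p" "p dvd n" using prime_factor_nat by blast
  then obtain m where m: "n = p * m" by blast
  have mI: "m \<in> I"
  proof (rule least)
    show "m \<in> steinitz S" using N n(1) m unfolding div_ideal_def by (metis dvd_triv_right)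
    show "m < n" using m \<open>n > 0\<close> prime_gt_1_nat[OF p(1)] by simp
  qed
  have pS: "p \<in> S"
  proof (rule ccontr)
    assume "p \<notin> S"
    then have "p = 2" using n(1) p by (auto simp: steinitz_def)
    then obtain m' where m': "lcm 2 m' = n" "n = 2 * m'" using steinitz_even_split[OF n(1)] p(2) by metis
    then have "m' = m" using m \<open>p = 2\<close> by simp
    then have "n \<in> I" using I True mI m'(1) unfolding div_ideal_def by blast
    then show False using n(2) by blast
  qed
  have mult: "p * j \<in> steinitz S" if j: "j \<in> steinitz S" for j
  proof -
    have "j > 0" using j by (simp add: steinitz_def)
    have "multiplicity 2 (p * j) = multiplicity 2 p + multiplicity 2 j"
      by (rule prime_elem_multiplicity_mult_distrib) (use p(1) \<open>j > 0\<close> in auto)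
    moreover have "multiplicity 2 p = 0" using odd[OF pS] by (simp add: not_dvd_imp_multiplicity_0)
    ultimately show ?thesis
      using j pS \<open>j > 0\<close> p(1) by (auto simp: steinitz_def prime_gt_0_nat prime_dvd_mult_iff dest: primes_dvd_imp_eq)
  qed
  \<comment> \<open>The exponent of \<open>p\<close> in the Steinitz number of \<open>I\<close> is raised by one.\<close>
  define J where "J = {r. \<exists>j\<in>I. r dvd p * j}"
  have "div_ideal J"
    unfolding div_ideal_def
  proof (intro conjI ballI allI impI)
    show "1 \<in> J" using mI by (auto simp: J_def)
    show "0 \<notin> J" using p(1) I by (auto simp: J_def div_ideal_def)
    show "\<And>a d. a \<in> J \<Longrightarrow> d dvd a \<Longrightarrow> d \<in> J" by (auto simp: J_def intro: dvd_trans)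
    fix a b assume "a \<in> J" "b \<in> J"
    then obtain j k where jk: "j \<in> I" "k \<in> I" "a dvd p * j" "b dvd p * k" by (auto simp: J_def)
    have "a dvd p * lcm j k" "b dvd p * lcm j k"
      using jk(3,4) by (meson dvd_lcm1 dvd_lcm2 dvd_refl dvd_trans mult_dvd_mono)+
    then have "lcm a b dvd p * lcm j k" by (rule lcm_least)
    moreover have "lcm j k \<in> I" using I jk unfolding div_ideal_def by blast
    ultimately show "lcm a b \<in> J" by (auto simp: J_def)
  qed
  moreover have "I \<subseteq> J" unfolding J_def using dvd_triv_right by blast
  moreover have "n \<in> J" unfolding J_def using mI m dvd_refl by blast
  moreover have "J \<subseteq> steinitz S"
  proof
    fix r assume "r \<in> J"
    then obtain j where "j \<in> I" "r dvd p * j" by (auto simp: J_def)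
    then show "r \<in> steinitz S" using mult[of j] max N unfolding div_ideal_def by blast
  qed
  moreover have "p * n \<notin> J"
  proof
    assume "p * n \<in> J"
    then obtain j where j: "j \<in> I" "p * n dvd p * j" by (auto simp: J_def)
    then have "n dvd j" using p(1) by (simp add: prime_gt_0_nat)
    then show False using j(1) n(2) I unfolding div_ideal_def by blast
  qed
  moreover have "p * n \<in> steinitz S" using mult n(1) by blast
  ultimately have "div_ideal J \<and> I \<subseteq> J \<and> J \<subset> steinitz S" "J \<noteq> I" using n(2) by blast+
  then show ?thesis using max by blast
qed

lemma subring_restrict_iff:
  assumes "subring A F2bar_ring"
  shows "subring T (F2bar_ring\<lparr>carrier := A\<rparr>) \<longleftrightarrow> subring T F2bar_ring \<and> T \<subseteq> A"
proof -
  interpret R: ring F2bar_ring by (rule ring_from_type_algebra)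
  interpret A: ring "F2bar_ring\<lparr>carrier := A\<rparr>" by (rule R.subring_is_ring[OF assms])
  have "T \<subseteq> A" if "subring T (F2bar_ring\<lparr>carrier := A\<rparr>)" using subringE(1)[OF that] by simp
  moreover have "T \<subseteq> carrier F2bar_ring" by (simp add: ring_of_type_algebra_def)
  ultimately show ?thesis
    using A.subring_iff[of T] R.subring_iff[of T] by auto
qed

lemma maximal_subring_frob_union:
  assumes N: "div_ideal N"
  shows "maximal_subring T (F2bar_ring\<lparr>carrier := frob_union N\<rparr>) \<longleftrightarrow>
    (\<exists>I. maximal_subideal I N \<and> T = frob_union I)" (is "?L \<longleftrightarrow> ?R")
proof -
  let ?K = "F2bar_ring\<lparr>carrier := frob_union N\<rparr>"
  note K = frob_union_subring[OF N]
  have sub: "subring T ?K \<longleftrightarrow> (\<exists>I. div_ideal I \<and> I \<subseteq> N \<and> T = frob_union I)" for T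
    using subring_is_frob_union[OF N, of T] frob_union_subring frob_union_mono_iff[OF _ N]
    unfolding subring_restrict_iff[OF K] by metis
  have eq: "frob_union I = frob_union J \<longleftrightarrow> I = J" if "div_ideal I" "div_ideal J" for I J
    using frob_union_mono_iff that by (metis subset_antisym subset_refl)
  show ?thesis
  proof
    assume L: ?L
    then obtain I where I: "div_ideal I" "I \<subseteq> N" "T = frob_union I"
      unfolding maximal_subring_def sub by blast
    have "I \<noteq> N" using L I by (auto simp: maximal_subring_def)
    moreover have "J = I" if J: "div_ideal J \<and> I \<subseteq> J \<and> J \<subset> N" for J
    proof -
      have "subring (frob_union J) ?K" unfolding sub using J by blast
      moreover have "T \<subseteq> frob_union J" using frob_union_mono_iff[OF I(1)] J I(3) by blast
      moreover have "frob_union J \<noteq> carrier ?K" using eq[OF _ N, of J] J by auto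
      ultimately have "frob_union J = T" using L unfolding maximal_subring_def by blast
      then show ?thesis using eq J I by blast
    qed
    ultimately show ?R using I unfolding maximal_subideal_def by blast
  next
    assume ?R
    then obtain I where I: "maximal_subideal I N" "T = frob_union I" by blast
    then have I': "div_ideal I" "I \<subset> N" unfolding maximal_subideal_def by auto
    have "subring T ?K" unfolding sub using I I' by blast
    moreover have "T \<noteq> carrier ?K" using eq[OF I'(1) N] I' I(2) by auto
    moreover have "T' = T" if T': "subring T' ?K" "T \<subseteq> T'" "T' \<noteq> carrier ?K" for T'
    proof -
      obtain J where J: "div_ideal J" "J \<subseteq> N" "T' = frob_union J" using T'(1) unfolding sub by blast
      have "I \<subseteq> J" using frob_union_mono_iff[OF I'(1) J(1)] T'(2) I(2) J(3) by blast
      moreover have "J \<noteq> N" using T'(3) J(3) by auto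
      ultimately have "J = I" using I(1) J unfolding maximal_subideal_def by blast
      then show ?thesis using I J by blast
    qed
    ultimately show ?L unfolding maximal_subring_def by blast
  qed
qed

definition steinitz_field :: "nat set \<Rightarrow> F2bar ring" where
  "steinitz_field S = F2bar_ring\<lparr>carrier := frob_union (steinitz S)\<rparr>"

lemma maximal_subrings_steinitz_field:
  assumes "\<And>p. p \<in> S \<Longrightarrow> odd p"
  shows "maximal_subrings (steinitz_field S) = {frob_union {n \<in> steinitz S. odd n}}"
  using maximal_subideal_odd[of S] maximal_subideal_unique[OF _ assms]
  unfolding maximal_subrings_def steinitz_field_def maximal_subring_frob_union[OF div_ideal_steinitz]
  by blast

lemma field_steinitz_field: "field (steinitz_field S)"
proof -
  interpret R: field F2bar_ring by (rule field_from_type_algebra)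
  have simps: "\<zero>\<^bsub>F2bar_ring\<^esub> = 0" "\<one>\<^bsub>F2bar_ring\<^esub> = 1" "\<And>x y. x \<otimes>\<^bsub>F2bar_ring\<^esub> y = x * y"
    "carrier F2bar_ring = UNIV" by (simp_all add: ring_of_type_algebra_def)
  have "subfield (frob_union (steinitz S)) F2bar_ring"
  proof (rule R.subfieldI'[OF frob_union_subring[OF div_ideal_steinitz]])
    fix k assume "k \<in> frob_union (steinitz S) - {\<zero>\<^bsub>F2bar_ring\<^esub>}"
    then obtain n where k: "k \<noteq> 0" "n \<in> steinitz S" "k \<in> frob_fix n" by (auto simp: simps frob_union_def)
    have "inv\<^bsub>F2bar_ring\<^esub> k = inverse k" by (rule R.comm_inv_char) (simp_all add: simps k(1))
    moreover have "inverse k \<in> frob_fix n" using k(3) by (simp add: frob_fix_def power_inverse)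
    ultimately show "inv\<^bsub>F2bar_ring\<^esub> k \<in> frob_union (steinitz S)" using k(2) by (auto simp: frob_union_def)
  qed
  then show ?thesis unfolding steinitz_field_def by (rule R.subfield_iff(2))
qed

text \<open>
  A root of \<open>X^(2^q) - X\<close> other than \<open>0\<close> and \<open>1\<close> has degree \<open>q\<close>, as its degree divides the prime \<open>q\<close>.
\<close>

lemma mem_iff_steinitz_field:
  assumes q: "prime q" "odd q"
  shows "q \<in> S \<longleftrightarrow> (\<exists>x\<in>frob_union (steinitz S). x \<noteq> 0 \<and> x \<noteq> 1 \<and> x ^ (2 ^ q) = x)"
proof
  have q0: "q > 0" using q(1) by (rule prime_gt_0_nat)
  assume "q \<in> S"
  have "multiplicity 2 q = 0" using q(2) by (simp add: not_dvd_imp_multiplicity_0)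
  then have "q \<in> steinitz S" using \<open>q \<in> S\<close> q0 q(1) by (auto simp: steinitz_def dest: primes_dvd_imp_eq)
  obtain x where x: "x \<in> frob_fix q" "frob_degree x = q" using ex_frob_degree[OF q0] by blast
  have "x \<notin> frob_fix 1" using frob_degree_dvd[OF x(1) q0, of 1] x(2) q(1) by auto
  then have "x \<noteq> 0 \<and> x \<noteq> 1" unfolding frob_fix_1_iff by blast
  then show "\<exists>x\<in>frob_union (steinitz S). x \<noteq> 0 \<and> x \<noteq> 1 \<and> x ^ (2 ^ q) = x"
    using x(1) \<open>q \<in> steinitz S\<close> by (auto simp: frob_union_def frob_fix_def)
next
  assume "\<exists>x\<in>frob_union (steinitz S). x \<noteq> 0 \<and> x \<noteq> 1 \<and> x ^ (2 ^ q) = x"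
  then obtain x where x: "x \<in> frob_union (steinitz S)" "x \<noteq> 0" "x \<noteq> 1" "x \<in> frob_fix q"
    by (auto simp: frob_fix_def)
  note d = frob_degree_in_ideal[OF div_ideal_steinitz x(1)]
  have "frob_degree x \<noteq> 1" using d(2) x(2,3) frob_fix_1_iff by metis
  then have "frob_degree x = q" using d(4)[OF x(4)] q(1) prime_nat_iff by blast
  then have "q \<in> steinitz S" using d(1) by simp
  then show "q \<in> S" using q by (auto simp: steinitz_def)
qed

lemma countable_frob_union: "0 \<notin> N \<Longrightarrow> countable (frob_union N)"
  unfolding frob_union_def
  by (rule countable_UN) (auto intro!: countable_finite finite_frob_fix intro: gr0I)

section \<open>Transport along isomorphisms and counting isomorphism classes\<close>

lemma field_is_ring: "field K \<Longrightarrow> ring K"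
  by (simp add: cring.axioms(1) domain.axioms(1) field.axioms(1))

lemma ring_iso_inverse_image:
  assumes "ring K" "h \<in> ring_iso K L" "S \<subseteq> carrier K"
  shows "inv_into (carrier K) h ` h ` S = S"
  using ring_iso_memE(5)[OF assms(2)] assms(3) by (intro inv_into_image_cancel) (auto simp: bij_betw_def)

lemma maximal_subring_image:
  assumes K: "ring K" and L: "ring L" and h: "h \<in> ring_iso K L" and S: "maximal_subring S K"
  shows "maximal_subring (h ` S) L"
proof -
  let ?g = "inv_into (carrier K) h"
  have g: "?g \<in> ring_iso L K" by (rule ring_iso_set_sym[OF K h])
  have hom: "ring_hom_ring K L h" "ring_hom_ring L K ?g"
    using h g K L by (auto intro!: ring_hom_ringI2 simp: ring_iso_def)
  note bij = ring_iso_memE(5)[OF h]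
  have hg: "h ` ?g ` T = T" if "T \<subseteq> carrier L" for T
    using that bij by (intro image_inv_into_cancel) (auto simp: bij_betw_def)
  have S': "subring S K" "S \<noteq> carrier K" using S by (auto simp: maximal_subring_def)
  have "subring (h ` S) L" by (rule ring_hom_ring.img_is_subring[OF hom(1) S'(1)])
  moreover have "h ` S \<noteq> carrier L"
  proof
    assume "h ` S = carrier L"
    then have "h ` S = h ` carrier K" using bij by (simp add: bij_betw_def)
    then have "S = carrier K" using inj_on_image_eq_iff[OF bij_betw_imp_inj_on[OF bij]] subringE(1)[OF S'(1)] by blast
    then show False using S'(2) by blast
  qed
  moreover have "T = h ` S" if T: "subring T L" "h ` S \<subseteq> T" "T \<noteq> carrier L" for T
  proof -
    have TL: "T \<subseteq> carrier L" by (rule subringE(1)[OF T(1)])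
    have "subring (?g ` T) K" by (rule ring_hom_ring.img_is_subring[OF hom(2) T(1)])
    moreover have "S \<subseteq> ?g ` T"
      using image_mono[OF T(2), of ?g] ring_iso_inverse_image[OF K h subringE(1)[OF S'(1)]] by simp
    moreover have "?g ` T \<noteq> carrier K"
    proof
      assume "?g ` T = carrier K"
      then have "T = h ` carrier K" using hg[OF TL] by simp
      then show False using T(3) bij by (simp add: bij_betw_def)
    qed
    ultimately have "?g ` T = S" using S unfolding maximal_subring_def by blast
    then show ?thesis using hg[OF TL] by simp
  qed
  ultimately show ?thesis unfolding maximal_subring_def by blast
qed

lemma maximal_subrings_image:
  assumes K: "ring K" and L: "ring L" and h: "h \<in> ring_iso K L"
  shows "maximal_subrings L = (`) h ` maximal_subrings K"
proof
  show "(`) h ` maximal_subrings K \<subseteq> maximal_subrings L"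
    using maximal_subring_image[OF K L h] by (auto simp: maximal_subrings_def)
  show "maximal_subrings L \<subseteq> (`) h ` maximal_subrings K"
  proof
    fix T assume T: "T \<in> maximal_subrings L"
    let ?g = "inv_into (carrier K) h"
    have "?g ` T \<in> maximal_subrings K"
      using T maximal_subring_image[OF L K ring_iso_set_sym[OF K h]] by (simp add: maximal_subrings_def)
    moreover have "h ` ?g ` T = T"
      using T ring_iso_memE(5)[OF h]
      by (intro image_inv_into_cancel) (auto simp: bij_betw_def maximal_subrings_def maximal_subring_def dest: subringE(1))
    ultimately show "T \<in> (`) h ` maximal_subrings K" by (metis image_eqI)
  qed
qed

text \<open>
  Both operations of a structure, read through a numbering of its elements. The Boolean tells
  multiplication from addition.
\<close>

definition op_graph :: "('a, 'b) ring_scheme \<Rightarrow> ('a \<Rightarrow> nat) \<Rightarrow> (bool \<times> nat \<times> nat \<times> nat) set" where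
  "op_graph K f = {(b, f x, f y, f (if b then x \<otimes>\<^bsub>K\<^esub> y else x \<oplus>\<^bsub>K\<^esub> y)) | b x y. x \<in> carrier K \<and> y \<in> carrier K}"

text \<open>
  The isomorphism matches elements with the same number. It preserves the unit because it is
  surjective and preserves multiplication.
\<close>

lemma op_graph_eq_imp_iso:
  assumes K: "ring K" and L: "ring L"
    and f: "inj_on f (carrier K)" and g: "inj_on g (carrier L)"
    and eq: "op_graph K f = op_graph L g"
  shows "K \<simeq> L"
proof -
  interpret K: ring K by fact
  interpret L: ring L by fact
  have fst_eq: "f' ` carrier M = (\<lambda>(b, x, y, z). x) ` op_graph M f'" for f' :: "'x \<Rightarrow> nat" and M :: "('x, 'y) ring_scheme"
  proof
    show "f' ` carrier M \<subseteq> (\<lambda>(b, x, y, z). x) ` op_graph M f'"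
    proof
      fix n assume "n \<in> f' ` carrier M"
      then obtain x where "x \<in> carrier M" "n = f' x" by blast
      then have "(True, n, n, f' (x \<otimes>\<^bsub>M\<^esub> x)) \<in> op_graph M f'"
        unfolding op_graph_def by (force intro: exI[of _ True])
      then show "n \<in> (\<lambda>(b, x, y, z). x) ` op_graph M f'" by force
    qed
  qed (auto simp: op_graph_def)
  have im: "f ` carrier K = g ` carrier L" unfolding fst_eq eq ..
  define h where "h x = inv_into (carrier L) g (f x)" for x
  have h: "h x \<in> carrier L" "g (h x) = f x" if "x \<in> carrier K" for x
    using that im f_inv_into_f[of "f x" g "carrier L"] inv_into_into[of "f x" g "carrier L"] by (auto simp: h_def)
  have ops: "h (if b then x \<otimes>\<^bsub>K\<^esub> y else x \<oplus>\<^bsub>K\<^esub> y) = (if b then h x \<otimes>\<^bsub>L\<^esub> h y else h x \<oplus>\<^bsub>L\<^esub> h y)"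
    if xy: "x \<in> carrier K" "y \<in> carrier K" for b x y
  proof -
    let ?z = "if b then x \<otimes>\<^bsub>K\<^esub> y else x \<oplus>\<^bsub>K\<^esub> y"
    have z: "?z \<in> carrier K" using xy by simp
    have "(b, f x, f y, f ?z) \<in> op_graph K f" using xy unfolding op_graph_def by blast
    then have "(b, f x, f y, f ?z) \<in> op_graph L g" by (simp only: eq)
    then obtain x' y' where xy': "x' \<in> carrier L" "y' \<in> carrier L" "g x' = f x" "g y' = f y"
      "g (if b then x' \<otimes>\<^bsub>L\<^esub> y' else x' \<oplus>\<^bsub>L\<^esub> y') = f ?z"
      unfolding op_graph_def by auto
    have eqs: "x' = h x" "y' = h y" using xy xy' h inj_onD[OF g] by auto
    have "g (h ?z) = g (if b then h x \<otimes>\<^bsub>L\<^esub> h y else h x \<oplus>\<^bsub>L\<^esub> h y)"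
      using xy'(5)[unfolded eqs] h(2)[OF z] by (simp only:)
    then show ?thesis using h(1) xy z by (intro inj_onD[OF g]) auto
  qed
  have bij: "bij_betw h (carrier K) (carrier L)"
    unfolding bij_betw_def
  proof
    show "inj_on h (carrier K)" using h(2) f unfolding inj_on_def by metis
    show "h ` carrier K = carrier L"
    proof
      show "carrier L \<subseteq> h ` carrier K"
      proof
        fix y assume y: "y \<in> carrier L"
        then obtain x where x: "x \<in> carrier K" "f x = g y" using im by (metis imageE imageI)
        then have "h x = y" using h[OF x(1)] y inj_onD[OF g] by auto
        then show "y \<in> h ` carrier K" using x by blast
      qed
    qed (use h in blast)
  qed
  have one: "h \<one>\<^bsub>K\<^esub> = \<one>\<^bsub>L\<^esub>"
  proof -
    obtain x where x: "x \<in> carrier K" "h x = \<one>\<^bsub>L\<^esub>"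
      using bij L.one_closed by (metis bij_betw_iff_bijections)
    have "h \<one>\<^bsub>K\<^esub> \<otimes>\<^bsub>L\<^esub> h x = h x" using ops[of "\<one>\<^bsub>K\<^esub>" x True] x(1) by simp
    then show ?thesis using x h(1)[of "\<one>\<^bsub>K\<^esub>"] by simp
  qed
  have "h \<in> ring_iso K L"
    using h ops[of _ _ True] ops[of _ _ False] one bij by (intro ring_iso_memI) auto
  then show ?thesis by (auto simp: is_ring_iso_def)
qed

lemma iso_class_eq_imp_iso:
  assumes "\<And>K. K \<in> \<F> \<Longrightarrow> ring K" "C \<in> iso_classes \<F>" "D \<in> iso_classes \<F>" "K \<in> C" "L \<in> D"
  shows "C = D \<longleftrightarrow> K \<simeq> L" "K \<in> \<F>" "L \<in> \<F>"
proof -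
  note equiv = equiv_ring_iso[of \<F>, OF assms(1)]
  have "C = D \<longleftrightarrow> (K, L) \<in> {(K, L). K \<in> \<F> \<and> L \<in> \<F> \<and> K \<simeq> L}"
    using quotient_eq_iff[OF equiv] assms(2-5) unfolding iso_classes_def by blast
  moreover show KL: "K \<in> \<F>" "L \<in> \<F>"
    using assms(2-5) in_quotient_imp_subset[OF equiv] unfolding iso_classes_def by blast+
  ultimately show "C = D \<longleftrightarrow> K \<simeq> L" by simp
qed

text \<open>
  A class is mapped to the operation graph of one of its members, coded as a set of numbers.
\<close>

lemma iso_classes_countable_lepoll:
  assumes "\<And>K. K \<in> \<F> \<Longrightarrow> ring K \<and> countable (carrier K)"
  shows "iso_classes \<F> \<lesssim> (UNIV :: nat set set)"
proof -
  define code where "code C = to_nat ` op_graph (SOME K. K \<in> C) (to_nat_on (carrier (SOME K. K \<in> C)))"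
    for C :: "'a ring set"
  have ring: "\<And>K. K \<in> \<F> \<Longrightarrow> ring K" using assms by blast
  have some: "(SOME K. K \<in> C) \<in> C" if "C \<in> iso_classes \<F>" for C
    using that in_quotient_imp_non_empty[OF equiv_ring_iso[OF ring]]
    unfolding iso_classes_def some_in_eq by blast
  have "inj_on code (iso_classes \<F>)"
  proof (rule inj_onI)
    fix C D assume CD: "C \<in> iso_classes \<F>" "D \<in> iso_classes \<F>" "code C = code D"
    define K L where "K = (SOME K. K \<in> C)" and "L = (SOME L. L \<in> D)"
    have KL: "K \<in> C" "L \<in> D" using some CD by (auto simp: K_def L_def)
    note * = iso_class_eq_imp_iso[OF ring CD(1,2) KL]
    have "op_graph K (to_nat_on (carrier K)) = op_graph L (to_nat_on (carrier L))"
      using CD(3) unfolding code_def K_def[symmetric] L_def[symmetric]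
      by (simp add: inj_image_eq_iff)
    then have "K \<simeq> L"
      by (intro op_graph_eq_imp_iso) (use * assms in \<open>auto intro: inj_on_to_nat_on\<close>)
    then show "C = D" using * by blast
  qed
  then show ?thesis unfolding lepoll_def by blast
qed

lemma iso_imp_same_fixed_points:
  assumes "field K" "field L" "K \<simeq> L"
    and "\<exists>x\<in>carrier K. x \<noteq> \<zero>\<^bsub>K\<^esub> \<and> x \<noteq> \<one>\<^bsub>K\<^esub> \<and> x [^]\<^bsub>K\<^esub> (n::nat) = x"
  shows "\<exists>x\<in>carrier L. x \<noteq> \<zero>\<^bsub>L\<^esub> \<and> x \<noteq> \<one>\<^bsub>L\<^esub> \<and> x [^]\<^bsub>L\<^esub> n = x"
proof -
  interpret K: field K by fact
  interpret L: field L by fact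
  obtain h where h: "h \<in> ring_iso K L" using assms(3) by (auto simp: is_ring_iso_def)
  interpret h: ring_hom_ring K L h
    by (rule ring_hom_ringI2) (use h K.ring_axioms L.ring_axioms in \<open>auto simp: ring_iso_def\<close>)
  have inj: "inj_on h (carrier K)" using ring_iso_memE(5)[OF h] by (simp add: bij_betw_def)
  obtain x where x: "x \<in> carrier K" "x \<noteq> \<zero>\<^bsub>K\<^esub>" "x \<noteq> \<one>\<^bsub>K\<^esub>" "x [^]\<^bsub>K\<^esub> n = x" using assms(4) by blast
  have "h x \<noteq> \<zero>\<^bsub>L\<^esub>" using inj_onD[OF inj _ x(1) K.zero_closed] x(2) h.hom_zero by auto
  moreover have "h x \<noteq> \<one>\<^bsub>L\<^esub>" using inj_onD[OF inj _ x(1) K.one_closed] x(3) h.hom_one by auto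
  moreover have "h x [^]\<^bsub>L\<^esub> n = h x" using h.hom_nat_pow[OF x(1), of n] x(4) by simp
  ultimately show ?thesis using x(1) h.hom_closed by blast
qed

lemma steinitz_field_iso_imp_subset:
  assumes S: "\<And>p. p \<in> S \<Longrightarrow> prime p \<and> odd p"
    and iso: "steinitz_field S \<simeq> steinitz_field T"
  shows "S \<subseteq> T"
proof
  have simps: "\<zero>\<^bsub>steinitz_field U\<^esub> = 0" "\<one>\<^bsub>steinitz_field U\<^esub> = 1" "x \<otimes>\<^bsub>steinitz_field U\<^esub> y = x * y"
    "carrier (steinitz_field U) = frob_union (steinitz U)" for U x y
    by (simp_all add: steinitz_field_def ring_of_type_algebra_def)
  have pow: "x [^]\<^bsub>steinitz_field U\<^esub> (n::nat) = x ^ n" for U x n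
    by (induction n) (simp_all add: simps mult.commute)
  fix q assume q: "q \<in> S"
  then have pq: "prime q" "odd q" using S by auto
  have "\<exists>x\<in>frob_union (steinitz S). x \<noteq> 0 \<and> x \<noteq> 1 \<and> x ^ (2 ^ q) = x"
    using mem_iff_steinitz_field[OF pq, of S] q by (simp only:)
  then have "\<exists>x\<in>frob_union (steinitz T). x \<noteq> 0 \<and> x \<noteq> 1 \<and> x ^ (2 ^ q) = x"
    by (rule iso_imp_same_fixed_points[OF field_steinitz_field field_steinitz_field iso,
          where n = "2 ^ q", unfolded simps pow])
  then show "q \<in> T" using mem_iff_steinitz_field[OF pq, of T] by (simp only:)
qed

text \<open>
  All Steinitz fields lie in the countable union of the finite fields, and one injection of this
  union into the infinite type copies them simultaneously.
\<close>

lemma ex_steinitz_copies: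
  assumes "infinite (UNIV :: 'a set)"
  obtains \<K> :: "nat set \<Rightarrow> 'a ring"
  where "\<And>S. field (\<K> S)" "\<And>S. steinitz_field S \<simeq> \<K> S"
    "\<And>S. (\<And>p. p \<in> S \<Longrightarrow> odd p) \<Longrightarrow> \<exists>M. maximal_subrings (\<K> S) = {M}"
proof -
  obtain e :: "nat \<Rightarrow> 'a" where e: "inj e" using infinite_countable_subset[OF assms] by blast
  define U where "U = frob_union {0<..}"
  define h where "h x = e (to_nat_on U x)" for x
  have "countable U" unfolding U_def by (rule countable_frob_union) simp
  then have "inj_on h U" using e inj_on_to_nat_on unfolding h_def inj_on_def by blast
  moreover have "carrier (steinitz_field S) \<subseteq> U" for S
    by (auto simp: steinitz_field_def U_def frob_union_def steinitz_def)
  ultimately have inj: "inj_on h (carrier (steinitz_field S))" for S using inj_on_subset by blast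
  define \<K> where "\<K> S = image_ring h (steinitz_field S)" for S
  have iso: "h \<in> ring_iso (steinitz_field S) (\<K> S)" for S
    unfolding \<K>_def by (rule inj_imp_image_ring_iso[OF inj])
  have field: "field (\<K> S)" for S
    unfolding \<K>_def by (rule field.inj_imp_image_ring_is_field[OF field_steinitz_field inj])
  have "\<exists>M. maximal_subrings (\<K> S) = {M}" if "\<And>p. p \<in> S \<Longrightarrow> odd p" for S
    using maximal_subrings_image[OF field_is_ring[OF field_steinitz_field] field_is_ring[OF field] iso]
      maximal_subrings_steinitz_field[OF that] by simp
  moreover have "steinitz_field S \<simeq> \<K> S" for S using iso unfolding is_ring_iso_def by blast
  ultimately show thesis using that[of \<K>] field by blast
qed

text \<open>
  A set of numbers is turned into a set of odd primes by an injection of the numbers into the odd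
  primes, and then into the class of the corresponding Steinitz field.
\<close>

lemma nat_sets_lepoll_iso_classes:
  assumes "infinite (UNIV :: 'a set)"
    and \<F>: "\<And>K. K \<in> \<F> \<Longrightarrow> field K"
    and one: "\<And>K :: 'a ring. field K \<Longrightarrow> \<exists>M. maximal_subrings K = {M} \<Longrightarrow> K \<in> \<F>"
  shows "(UNIV :: nat set set) \<lesssim> iso_classes \<F>"
proof -
  obtain \<K> :: "nat set \<Rightarrow> 'a ring" where \<K>: "\<And>S. field (\<K> S)" "\<And>S. steinitz_field S \<simeq> \<K> S"
    "\<And>S. (\<And>p. p \<in> S \<Longrightarrow> odd p) \<Longrightarrow> \<exists>M. maximal_subrings (\<K> S) = {M}"
    using ex_steinitz_copies[OF assms(1)] by metis
  have "{p :: nat. prime p} \<subseteq> insert 2 {p. prime p \<and> odd p}"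
    using prime_odd_nat prime_ge_2_nat by (metis (mono_tags, lifting) insertCI le_neq_implies_less mem_Collect_eq subsetI)
  then have "infinite {p :: nat. prime p \<and> odd p}"
    using primes_infinite finite_subset by blast
  then obtain e :: "nat \<Rightarrow> nat" where e: "inj e" "range e \<subseteq> {p. prime p \<and> odd p}"
    using infinite_countable_subset by blast
  define r where "r = {(K, L). K \<in> \<F> \<and> L \<in> \<F> \<and> K \<simeq> L}"
  have ring: "ring K" if "K \<in> \<F>" for K
    by (rule field_is_ring[OF \<F>[OF that]])
  have mem: "\<K> (e ` A) \<in> \<F>" for A
    by (rule one[OF \<K>(1) \<K>(3)]) (use e(2) in auto)
  define c where "c A = r `` {\<K> (e ` A)}" for A
  have "c A \<in> iso_classes \<F>" for A
    unfolding c_def iso_classes_def r_def[symmetric] by (rule quotientI[OF mem])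
  moreover have "\<K> (e ` A) \<in> c A" for A
    using mem[of A] ring_iso_refl by (simp add: c_def r_def)
  ultimately have c: "c A \<in> iso_classes \<F>" "\<K> (e ` A) \<in> c A" for A by blast+
  have "A \<subseteq> B" if "c A = c B" for A B
  proof -
    have AB: "\<K> (e ` A) \<simeq> \<K> (e ` B)"
      using iso_class_eq_imp_iso(1)[OF ring c(1) c(1) c(2) c(2)] that by blast
    have B: "\<K> (e ` B) \<simeq> steinitz_field (e ` B)"
      by (rule ring_iso_sym[OF field_is_ring[OF field_steinitz_field] \<K>(2)])
    have "steinitz_field (e ` A) \<simeq> steinitz_field (e ` B)"
      by (rule ring_iso_trans[OF \<K>(2) ring_iso_trans[OF AB B]])
    then have "e ` A \<subseteq> e ` B" by (rule steinitz_field_iso_imp_subset[rotated]) (use e(2) in auto)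
    then show ?thesis using e(1) by (simp add: inj_image_subset_iff)
  qed
  then have "inj c" by (intro injI) blast
  then show ?thesis using c(1) unfolding lepoll_def by blast
qed

lemma finitely_many_imp_countable:
  assumes "field K" "finite (maximal_subrings K)"
  shows "ring K \<and> countable (carrier K)"
proof -
  interpret field K by fact
  show ?thesis using uncountable_imp_infinite_maximal_subrings assms(2) ring_axioms by blast
qed

theorem corollary2p4:
  assumes "infinite (UNIV :: 'a set)"
  shows "iso_classes (finmax_fields :: 'a ring set) \<approx> (UNIV :: nat set set) \<and>
         iso_classes (finmax_fields_nonempty :: 'a ring set) \<approx> (UNIV :: nat set set)"
proof (intro conjI lepoll_antisym)
  show "iso_classes (finmax_fields :: 'a ring set) \<lesssim> (UNIV :: nat set set)"
    by (intro iso_classes_countable_lepoll) (auto simp: finmax_fields_def finitely_many_imp_countable)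
  show "iso_classes (finmax_fields_nonempty :: 'a ring set) \<lesssim> (UNIV :: nat set set)"
    by (intro iso_classes_countable_lepoll) (auto simp: finmax_fields_nonempty_def finitely_many_imp_countable)
  show "(UNIV :: nat set set) \<lesssim> iso_classes (finmax_fields :: 'a ring set)"
    by (rule nat_sets_lepoll_iso_classes[OF assms]) (auto simp: finmax_fields_def)
  show "(UNIV :: nat set set) \<lesssim> iso_classes (finmax_fields_nonempty :: 'a ring set)"
    by (rule nat_sets_lepoll_iso_classes[OF assms]) (auto simp: finmax_fields_nonempty_def)
qed

end
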